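(* Let $f$ be a probability density on $[1,\infty)$, let $X,X_1,X_2,\ldots$ be i.i.d. with density $f$, let $\mu:=E[X^{3/4}]$, and for $n\ge1$ let $$\hat S_n:=\frac1n\sum_{i=1}^nX_i^{3/4},\qquad \hat T_n:=\frac1n\sum_{i=1}^nX_i.$$ (i) If $f(x)=\frac{5}{2x^{7/2}}$ for $x\ge1$, then for any $\varepsilon>0$, $$\Pr\{\hat S_n-\mu>\varepsilon\}\sim\frac{1}{\varepsilon^{10/3}n^{7/3}},\qquad n\to\infty.$$ (ii) If the mean of $f$ is $\nu=E[X]=5/3$ (and nothing else is assumed about $f$), then for all $\varepsilon,u>0$ there exists $I(\varepsilon,u)>0$ such that $$\Pr\{\hat S_n-\mu>\varepsilon\text{ and }|\hat T_n-\tfrac53|<u\}\le e^{-nI(\varepsilon,u)}\qquad\text{for all }n\ge1.$$ (iii) If the mean of $f$ is $5/3$ and, in addition, the variance of $f$ equals $20/9$, then for any $\varepsilon>0$ and any $0<u\le\frac{\varepsilon}{20}$, $$\Pr\{\hat S_n-\mu>\varepsilon\text{ and }|\hat T_n-\tfrac53|<u\}\le e^{-(0.005)\times n\varepsilon^2}\qquad\text{for all }n\ge1.$$ (iv) If the mean of $f$ is $5/3$, the variance of $f$ equals $20/9$ and, in addition, the covariance between $X^{3/4}$ and $X$ under $f$ is $20/21$, then for any $\varepsilon>0$ and any $0<u\le\frac{\varepsilon}{20}$, $$\Pr\{\hat S_n-\mu>\varepsilon\text{ and }|\hat T_n-\tfrac53|<u\}\le e^{-(0.0367)\times n\varepsilon^2}\qquad\text{for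 all }n\ge1.$$
   Context: The notation $a_n\sim b_n$ means $a_n/b_n\to1$ as $n\to\infty$. *)

theory Defs
  imports "HOL-Probability.Probability" "HOL-Library.Landau_Symbols"
begin

(* A density on [1, infinity) is represented by its extension by zero to the real line. *)
definition density_on_ge_1 :: "(real \<Rightarrow> real) \<Rightarrow> bool" where
  "density_on_ge_1 f \<longleftrightarrow>
     f \<in> borel_measurable borel \<and> (\<forall>x. 0 \<le> f x) \<and> (\<forall>x<1. f x = 0) \<and>
     (\<integral>\<^sup>+x. ennreal (f x) \<partial>lborel) = 1"

(* X 0 plays the role of the generic copy X; the sample is X 1, X 2, ... *)
definition iid_with_density :: "'a measure \<Rightarrow> (nat \<Rightarrow> 'a \<Rightarrow> real) \<Rightarrow> (real \<Rightarrow> real) \<Rightarrow> bool" where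
  "iid_with_density M X f \<longleftrightarrow>
     prob_space.indep_vars M (\<lambda>_. borel) X UNIV \<and>
     (\<forall>i. distributed M lborel (X i) (\<lambda>x. ennreal (f x)))"

(* The Bochner integral of a non-integrable function is 0, so requiring an expectation,
   variance or covariance to equal a nonzero number also requires that it exists. *)
definition covariance :: "'a measure \<Rightarrow> ('a \<Rightarrow> real) \<Rightarrow> ('a \<Rightarrow> real) \<Rightarrow> real" where
  "covariance M Y Z =
     prob_space.expectation M
       (\<lambda>\<omega>. (Y \<omega> - prob_space.expectation M Y) * (Z \<omega> - prob_space.expectation M Z))"

definition S_hat :: "(nat \<Rightarrow> 'a \<Rightarrow> real) \<Rightarrow> nat \<Rightarrow> 'a \<Rightarrow> real" where
  "S_hat X n \<omega> = (1 / real n) * (\<Sum>i=1..n. X i \<omega> powr (3/4))"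

definition T_hat :: "(nat \<Rightarrow> 'a \<Rightarrow> real) \<Rightarrow> nat \<Rightarrow> 'a \<Rightarrow> real" where
  "T_hat X n \<omega> = (1 / real n) * (\<Sum>i=1..n. X i \<omega>)"

end

theory Submission
  imports Defs "HOL-Real_Asymp.Real_Asymp"
begin

text \<open>
  For the Pareto density, a deviation of the sum of order \<open>n\<close> is produced by one big jump. The
  events that some centred summand exceeds \<open>n (\<epsilon> \<plusminus> \<delta>)\<close> while the others contribute
  at most \<open>n \<delta>\<close> in absolute value (Chebyshev) give the right order; when all summands are below
  a small multiple of \<open>n\<close>, an exponential tilt of order \<open>ln n / n\<close> makes the probability
  negligible.

  For the joint events, subtract a multiple of the control variable: on the event the mean of
  \<open>X powr (3/4) - \<mu> - \<eta> (X - 5/3)\<close> exceeds \<open>\<epsilon> - \<eta> u\<close>, and this variable is bounded above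
  because \<open>x powr (3/4) - \<eta> x\<close> is. So its positive exponential moments are finite, and Chernoff's
  method applies. For \<open>\<eta> = 3/4\<close> the function is \<open>3/4\<close>-Lipschitz on \<open>[1, \<infinity>)\<close>, so
  the variance is at most \<open>9/16 * 20/9 = 5/4\<close>, while the variable is at most \<open>1/2\<close>.
\<close>

section \<open>An exponential inequality and a right-limit witness\<close>

text \<open>For nonnegative \<open>x\<close> this is Taylor's formula of order two, with the factor
  1/2 of the remainder dropped. For negative \<open>x\<close> the quadratic alone suffices. The
  correction depends on \<open>x\<close> only through an upper bound \<open>m\<close>, so it suits
  variables that are unbounded below.\<close>

lemma exp_le_quadratic:
  fixes x m :: real
  assumes "x \<le> m" "0 \<le> m"
  shows "exp x \<le> 1 + x + x\<^sup>2 * exp m"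
proof (cases "0 \<le> x")
  case True
  obtain t where t: "\<bar>t\<bar> \<le> \<bar>x\<bar>" "exp x = (\<Sum>i<2. x ^ i / fact i) + exp t / fact 2 * x ^ 2"
    using Maclaurin_exp_le[of x 2] by blast
  have "exp t \<le> exp m" using t(1) True assms by simp
  then have "exp t / fact 2 \<le> exp m / 1" by (intro frac_le) auto
  then have "exp t / fact 2 * x\<^sup>2 \<le> exp m * x\<^sup>2"
    by (intro mult_right_mono) simp_all
  with t(2) show ?thesis by (simp add: numeral_2_eq_2 mult.commute)
next
  case False
  \<comment> \<open>The product equals \<open>1 - x^3\<close>, and \<open>x\<close> is negative
    here.\<close>
  then have "1 \<le> (1 + x + x\<^sup>2) * (1 - x)"
    using zero_le_power_eq[of "-x" 3] by (auto simp: algebra_simps power2_eq_square power3_eq_cube mult_le_0_iff)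
  then have "1 / (1 - x) \<le> 1 + x + x\<^sup>2"
    using False by (simp add: divide_le_eq)
  moreover have "exp x \<le> 1 / (1 - x)"
    using exp_ge_add_one_self[of "- x"] False by (simp add: exp_minus field_simps)
  moreover have "x\<^sup>2 * 1 \<le> x\<^sup>2 * exp m"
    using assms by (intro mult_left_mono) auto
  ultimately show ?thesis by simp
qed

lemma eventually_at_right_zeroE:
  fixes P :: "real \<Rightarrow> bool"
  assumes "\<forall>\<^sub>F d in at_right 0. P d"
  obtains d where "0 < d" "P d"
proof -
  have "\<forall>\<^sub>F d in at_right 0. P d \<and> 0 < d"
    using assms eventually_at_right_less by (rule eventually_conj)
  then show thesis
    using eventually_happens'[OF trivial_limit_at_right_real[of 0]] that by blast
qed

section \<open>Independent identically distributed sequences\<close>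

text \<open>Identical distribution is an equality of push-forward measures, so that a change of
  variables carries integrals, tails and almost sure statements from the generic copy
  \<open>Z 0\<close> to every \<open>Z i\<close>.\<close>

locale iid_sequence = prob_space M for M :: "'a measure" +
  fixes Z :: "nat \<Rightarrow> 'a \<Rightarrow> real"
  assumes indep: "indep_vars (\<lambda>_. borel) Z UNIV"
    and ident: "\<And>i. distr M borel (Z i) = distr M borel (Z 0)"
begin

lemma rv [measurable]: "random_variable borel (Z i)"
  using indep unfolding indep_vars_def2 by simp

lemma integrable_ident:
  fixes g :: "real \<Rightarrow> real"
  assumes [measurable]: "g \<in> borel_measurable borel" and "integrable M (\<lambda>\<omega>. g (Z 0 \<omega>))"
  shows "integrable M (\<lambda>\<omega>. g (Z i \<omega>))"
proof -
  have "integrable M (\<lambda>\<omega>. g (Z j \<omega>)) \<longleftrightarrow> integrable (distr M borel (Z j)) g" for j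
    by (simp add: integrable_distr_eq)
  with assms(2) show ?thesis by (simp add: ident[of i])
qed

lemma expectation_ident:
  fixes g :: "real \<Rightarrow> real"
  assumes [measurable]: "g \<in> borel_measurable borel"
  shows "expectation (\<lambda>\<omega>. g (Z i \<omega>)) = expectation (\<lambda>\<omega>. g (Z 0 \<omega>))"
  by (simp add: integral_distr[symmetric, of _ _ borel] ident[of i])

lemma prob_gt_ident:
  "prob {\<omega> \<in> space M. Z i \<omega> > y} = prob {\<omega> \<in> space M. Z 0 \<omega> > y}"
proof -
  have "prob {\<omega> \<in> space M. Z i \<omega> > y} = measure (distr M borel (Z i)) {y<..}" for i
    by (subst measure_distr) (auto intro!: arg_cong[where f = prob])
  then show ?thesis by (simp add: ident[of i])
qed

lemma iid_sequence_compose: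
  fixes g :: "real \<Rightarrow> real"
  assumes [measurable]: "g \<in> borel_measurable borel"
  shows "iid_sequence M (\<lambda>i \<omega>. g (Z i \<omega>))"
proof unfold_locales
  show "indep_vars (\<lambda>_. borel) (\<lambda>i \<omega>. g (Z i \<omega>)) UNIV"
    by (rule indep_vars_compose2[OF indep]) simp
  show "distr M borel (\<lambda>\<omega>. g (Z i \<omega>)) = distr M borel (\<lambda>\<omega>. g (Z 0 \<omega>))" for i
    using distr_distr[of g borel borel "Z i" M] distr_distr[of g borel borel "Z 0" M]
    by (simp add: ident[of i] comp_def)
qed

text \<open>Markov's inequality at level 1, followed by factorisation of the expectation. This is
  Chernoff's method for a general weight \<open>w\<close>: allowing \<open>w\<close> to vanish lets
  a truncation be built into the weight.\<close>

lemma prob_prod_ge_one: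
  fixes w :: "real \<Rightarrow> real"
  assumes [measurable]: "w \<in> borel_measurable borel" and nonneg: "\<And>x. 0 \<le> w x"
    and int: "integrable M (\<lambda>\<omega>. w (Z 0 \<omega>))" and "finite I"
  shows "prob {\<omega> \<in> space M. (\<Prod>i\<in>I. w (Z i \<omega>)) \<ge> 1} \<le> expectation (\<lambda>\<omega>. w (Z 0 \<omega>)) ^ card I"
proof -
  have ind: "indep_vars (\<lambda>_. borel) (\<lambda>i \<omega>. w (Z i \<omega>)) I"
    by (rule indep_vars_subset[OF indep_vars_compose2[OF indep]]) auto
  have "integrable M (\<lambda>\<omega>. \<Prod>i\<in>I. w (Z i \<omega>))"
    using \<open>finite I\<close> ind integrable_ident[OF _ int] by (rule indep_vars_integrable) simp
  then have "prob {\<omega> \<in> space M. (\<Prod>i\<in>I. w (Z i \<omega>)) \<ge> 1} \<le> expectation (\<lambda>\<omega>. \<Prod>i\<in>I. w (Z i \<omega>)) / 1"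
    by (intro integral_Markov_inequality_measure[where A = "{}"]) (auto intro: prod_nonneg nonneg)
  also have "expectation (\<lambda>\<omega>. \<Prod>i\<in>I. w (Z i \<omega>)) = (\<Prod>i\<in>I. expectation (\<lambda>\<omega>. w (Z i \<omega>)))"
    using \<open>finite I\<close> ind integrable_ident[OF _ int] by (rule indep_vars_lebesgue_integral) simp
  also have "\<dots> = expectation (\<lambda>\<omega>. w (Z 0 \<omega>)) ^ card I"
    by (subst expectation_ident) (auto simp: prod_constant)
  finally show ?thesis by simp
qed

lemma indep_var_sum_others:
  assumes "finite J" "i \<notin> J"
  shows "indep_var borel (Z i) borel (\<lambda>\<omega>. \<Sum>j\<in>J. Z j \<omega>)"
  by (rule indep_vars_sum[OF assms indep_vars_subset[OF indep]]) simp

text \<open>One summand is independent of the sum of the others. Leaving the condition on that sum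
  as a predicate \<open>P\<close> makes the same fact serve for small fluctuations, for large ones,
  and for a second jump.\<close>

lemma prob_gt_and_sum:
  assumes "finite J" "i \<notin> J" and [measurable]: "Measurable.pred borel P"
  shows "prob {\<omega> \<in> space M. Z i \<omega> > y \<and> P (\<Sum>j\<in>J. Z j \<omega>)} =
    prob {\<omega> \<in> space M. Z 0 \<omega> > y} * prob {\<omega> \<in> space M. P (\<Sum>j\<in>J. Z j \<omega>)}"
proof -
  have "{x. P x} \<in> sets borel" by measurable
  then have "prob ((\<lambda>\<omega>. (Z i \<omega>, \<Sum>j\<in>J. Z j \<omega>)) -` ({y<..} \<times> {x. P x}) \<inter> space M) =
      prob (Z i -` {y<..} \<inter> space M) * prob ((\<lambda>\<omega>. \<Sum>j\<in>J. Z j \<omega>) -` {x. P x} \<inter> space M)"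
    by (intro indep_varD[OF indep_var_sum_others[OF assms(1,2)]]) auto
  also have "Z i -` {y<..} \<inter> space M = {\<omega> \<in> space M. Z i \<omega> > y}" by auto
  also have "(\<lambda>\<omega>. \<Sum>j\<in>J. Z j \<omega>) -` {x. P x} \<inter> space M = {\<omega> \<in> space M. P (\<Sum>j\<in>J. Z j \<omega>)}" by auto
  also have "(\<lambda>\<omega>. (Z i \<omega>, \<Sum>j\<in>J. Z j \<omega>)) -` ({y<..} \<times> {x. P x}) \<inter> space M =
      {\<omega> \<in> space M. Z i \<omega> > y \<and> P (\<Sum>j\<in>J. Z j \<omega>)}" by auto
  finally show ?thesis by (simp only: prob_gt_ident[of y i])
qed

end

section \<open>Centred sequences with finite variance: Chebyshev and truncated Chernoff
  bounds\<close>

locale centered_iid_sequence = iid_sequence +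
  assumes int: "integrable M (Z 0)" and int_sq: "integrable M (\<lambda>\<omega>. (Z 0 \<omega>)\<^sup>2)"
    and mean_zero: "expectation (Z 0) = 0"
begin

abbreviation "V \<equiv> expectation (\<lambda>\<omega>. (Z 0 \<omega>)\<^sup>2)"
abbreviation "G y \<equiv> prob {\<omega> \<in> space M. Z 0 \<omega> > y}"

text \<open>Cross terms have expectation zero by independence and centring. Both claims go through
  one induction, because splitting the expectation of the expanded square requires each piece to be
  integrable.\<close>

lemma
  assumes "finite I"
  shows integrable_sum_sq: "integrable M (\<lambda>\<omega>. (\<Sum>i\<in>I. Z i \<omega>)\<^sup>2)" (is ?int)
    and expectation_sum_sq: "expectation (\<lambda>\<omega>. (\<Sum>i\<in>I. Z i \<omega>)\<^sup>2) = card I * V" (is ?eq)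
proof -
  have i: "integrable M (Z i)" for i using integrable_ident[of "\<lambda>x. x" i] int by simp
  have i2: "integrable M (\<lambda>\<omega>. (Z i \<omega>)\<^sup>2)" for i
    using integrable_ident[of "\<lambda>x. x\<^sup>2" i] int_sq by simp
  have m: "expectation (Z i) = 0" for i using expectation_ident[of "\<lambda>x. x" i] mean_zero by simp
  have "?int \<and> ?eq" using assms
  proof induction
    case (insert i I)
    let ?S = "\<lambda>\<omega>. \<Sum>j\<in>I. Z j \<omega>"
    note ind = indep_var_sum_others[OF insert(1,2)]
    have iS: "integrable M ?S" using i by simp
    have iP: "integrable M (\<lambda>\<omega>. Z i \<omega> * ?S \<omega>)" 
      by (rule indep_var_integrable[OF ind i iS])
    have P0: "expectation (\<lambda>\<omega>. Z i \<omega> * ?S \<omega>) = 0"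
      using indep_var_lebesgue_integral[OF ind i iS] m by simp
    have sq: "(\<Sum>j\<in>insert i I. Z j \<omega>)\<^sup>2 = (Z i \<omega>)\<^sup>2 + ((?S \<omega>)\<^sup>2 + 2 * (Z i \<omega> * ?S \<omega>))" for \<omega>
      using insert(1,2) by (simp add: power2_sum)
    have "expectation (\<lambda>\<omega>. (Z i \<omega>)\<^sup>2) = V"
      using expectation_ident[of "\<lambda>x. x\<^sup>2" i] by simp
    then show ?case unfolding sq
      using insert i2[of i] iP P0 by (simp add: algebra_simps)
  qed (simp add: prob_space)
  then show ?int ?eq by auto
qed

lemma chebyshev_sum:
  assumes "finite I" "0 < a"
  shows "prob {\<omega> \<in> space M. a \<le> \<bar>\<Sum>i\<in>I. Z i \<omega>\<bar>} \<le> card I * V / a\<^sup>2"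
proof -
  have i: "integrable M (Z i)" for i using integrable_ident[of "\<lambda>x. x" i] int by simp
  have m: "expectation (Z i) = 0" for i using expectation_ident[of "\<lambda>x. x" i] mean_zero by simp
  have "expectation (\<lambda>\<omega>. \<Sum>i\<in>I. Z i \<omega>) = 0" using i m by simp
  then show ?thesis
    using Chebyshev_inequality[of "\<lambda>\<omega>. \<Sum>i\<in>I. Z i \<omega>" a] integrable_sum_sq[OF assms(1)]
      expectation_sum_sq[OF assms(1)] assms(2) by simp
qed

text \<open>The weight \<open>w\<close> is an exponential tilt set to zero above \<open>b\<close>,
  so its product is at least 1 on the event. A single quadratic dominates \<open>w\<close>
  everywhere: below \<open>b\<close> by \<open>exp_le_quadratic\<close> with
  \<open>m = l * b\<close>, above \<open>b\<close> because the quadratic is nonnegative there.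
  Integrating this quadratic against the untruncated law removes the linear term, so the truncated
  variable never has to be centred anew.\<close>

lemma truncated_chernoff:
  assumes "0 \<le> l" "0 \<le> b" "finite I"
  shows "prob {\<omega> \<in> space M. real (card I) * t \<le> (\<Sum>i\<in>I. Z i \<omega>) \<and> (\<forall>i\<in>I. Z i \<omega> \<le> b)}
    \<le> exp (real (card I) * (l\<^sup>2 * V * exp (l * b) - l * t))"
proof -
  define w where "w x = (if x \<le> b then exp (l * (x - t)) else 0)" for x
  have w [measurable]: "w \<in> borel_measurable borel" unfolding w_def by measurable
  have bound: "w x \<le> exp (- (l * t)) * (1 + l * x + x\<^sup>2 * (l\<^sup>2 * exp (l * b)))" for x
  proof -
    have e: "exp (l * x) \<le> 1 + l * x + x\<^sup>2 * (l\<^sup>2 * exp (l * b))" if "x \<le> b"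
      using exp_le_quadratic[OF mult_left_mono[OF that], of l] assms
      by (simp add: power_mult_distrib mult_ac)
    have n: "0 \<le> 1 + l * x + x\<^sup>2 * (l\<^sup>2 * exp (l * b))" if "b < x"
      using that assms by (intro add_nonneg_nonneg mult_nonneg_nonneg) auto
    show ?thesis
    proof (cases "x \<le> b")
      case True
      have "w x = exp (- (l * t)) * exp (l * x)"
        using True by (simp add: w_def exp_add[symmetric] algebra_simps)
      then show ?thesis using e[OF True] by simp
    next
      case False
      then show ?thesis using n by (simp add: w_def)
    qed
  qed
  have wn: "0 \<le> w x" for x by (simp add: w_def)
  have ib: "integrable M (\<lambda>\<omega>. exp (- (l * t)) * (1 + l * Z 0 \<omega> + (Z 0 \<omega>)\<^sup>2 * (l\<^sup>2 * exp (l * b))))"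
    using int int_sq by (intro integrable_mult_right Bochner_Integration.integrable_add integrable_mult_left) auto
  have iw: "integrable M (\<lambda>\<omega>. w (Z 0 \<omega>))"
    by (rule Bochner_Integration.integrable_bound[OF ib]) (use bound wn in \<open>auto intro!: AE_I2 intro: order_trans[OF _ abs_ge_self]\<close>)
  have "expectation (\<lambda>\<omega>. w (Z 0 \<omega>)) \<le>
      expectation (\<lambda>\<omega>. exp (- (l * t)) * (1 + l * Z 0 \<omega> + (Z 0 \<omega>)\<^sup>2 * (l\<^sup>2 * exp (l * b))))"
    by (rule integral_mono[OF iw ib]) (rule bound)
  also have "\<dots> = exp (- (l * t)) * (1 + V * (l\<^sup>2 * exp (l * b)))"
    using int int_sq mean_zero by (simp add: prob_space)
  also have "\<dots> \<le> exp (- (l * t)) * exp (V * (l\<^sup>2 * exp (l * b)))"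
    by (intro mult_left_mono exp_ge_add_one_self) auto
  also have "\<dots> = exp (l\<^sup>2 * V * exp (l * b) - l * t)"
    by (simp add: exp_add[symmetric] algebra_simps)
  finally have E: "expectation (\<lambda>\<omega>. w (Z 0 \<omega>)) \<le> exp (l\<^sup>2 * V * exp (l * b) - l * t)" .
  have "1 \<le> (\<Prod>i\<in>I. w (Z i \<omega>))"
    if "real (card I) * t \<le> (\<Sum>i\<in>I. Z i \<omega>)" "\<forall>i\<in>I. Z i \<omega> \<le> b" for \<omega>
  proof -
    have "(\<Prod>i\<in>I. w (Z i \<omega>)) = (\<Prod>i\<in>I. exp (l * (Z i \<omega> - t)))"
      using that by (intro prod.cong) (auto simp: w_def)
    also have "\<dots> = exp (l * ((\<Sum>i\<in>I. Z i \<omega>) - real (card I) * t))"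
      using assms(3) by (simp add: exp_sum[symmetric] sum_distrib_left[symmetric] sum_subtractf)
    finally show ?thesis using that assms(1) by simp
  qed
  then have "prob {\<omega> \<in> space M. real (card I) * t \<le> (\<Sum>i\<in>I. Z i \<omega>) \<and> (\<forall>i\<in>I. Z i \<omega> \<le> b)}
      \<le> prob {\<omega> \<in> space M. (\<Prod>i\<in>I. w (Z i \<omega>)) \<ge> 1}"
    by (intro finite_measure_mono) auto
  also have "\<dots> \<le> expectation (\<lambda>\<omega>. w (Z 0 \<omega>)) ^ card I"
    by (rule prob_prod_ge_one[OF w wn iw assms(3)])
  also have "\<dots> \<le> exp (l\<^sup>2 * V * exp (l * b) - l * t) ^ card I"
    by (intro power_mono E integral_nonneg_AE AE_I2 wn)
  finally show ?thesis by (simp add: exp_of_nat_mult)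
qed

lemma chebyshev_sum_others:
  assumes "n \<ge> 1" "0 < d" "i \<in> {1..n}"
  shows "prob {\<omega> \<in> space M. n * d \<le> \<bar>\<Sum>j\<in>{1..n}-{i}. Z j \<omega>\<bar>} \<le> V / (n * d\<^sup>2)"
proof -
  have "prob {\<omega> \<in> space M. n * d \<le> \<bar>\<Sum>j\<in>{1..n}-{i}. Z j \<omega>\<bar>} \<le> real (n - 1) * V / (n * d)\<^sup>2"
    using chebyshev_sum[of "{1..n} - {i}" "n * d"] assms by simp
  also have "\<dots> \<le> n * V / (n * d)\<^sup>2"
    by (intro divide_right_mono mult_right_mono) auto
  also have "\<dots> = V / (n * d\<^sup>2)"
    using assms by (simp add: field_simps power2_eq_square)
  finally show ?thesis .
qed

section \<open>Finite-sample bounds for a single big jump\<close>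

text \<open>If some summand exceeds \<open>s\<close>, then either it exceeds
  \<open>n * (e - d)\<close> or the others add up to at least \<open>n * d\<close>; if none does,
  the truncated Chernoff bound applies. In the second case independence supplies the factor
  \<open>G s\<close>, without which the union bound over \<open>n\<close> indices would leave the
  constant \<open>V / d^2\<close>.\<close>

lemma one_big_jump_upper:
  assumes "n \<ge> 1" "0 < d" "0 \<le> l" "0 \<le> s"
  shows "prob {\<omega> \<in> space M. (\<Sum>i=1..n. Z i \<omega>) > real n * e}
    \<le> n * G (n * (e - d)) + n * G s * (V / (n * d\<^sup>2)) + exp (n * (l\<^sup>2 * V * exp (l * s) - l * e))"
proof -
  have card_n: "real (card {1..n}) = n" by simp
  let ?A = "\<lambda>i. {\<omega> \<in> space M. Z i \<omega> > n * (e - d)}"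
  let ?B = "\<lambda>i. {\<omega> \<in> space M. Z i \<omega> > s \<and> n * d \<le> \<bar>\<Sum>j\<in>{1..n}-{i}. Z j \<omega>\<bar>}"
  let ?C = "{\<omega> \<in> space M. n * e \<le> (\<Sum>i=1..n. Z i \<omega>) \<and> (\<forall>i\<in>{1..n}. Z i \<omega> \<le> s)}"
  have "{\<omega> \<in> space M. (\<Sum>i=1..n. Z i \<omega>) > real n * e} \<subseteq> (\<Union>i\<in>{1..n}. ?A i) \<union> (\<Union>i\<in>{1..n}. ?B i) \<union> ?C"
  proof safe
    fix \<omega> assume \<omega>: "\<omega> \<in> space M" "(\<Sum>i=1..n. Z i \<omega>) > real n * e"
      "\<omega> \<notin> (\<Union>i\<in>{1..n}. ?B i)" "\<omega> \<notin> (\<Union>i\<in>{1..n}. ?A i)" 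
    show "Z i \<omega> \<le> s" if "i \<in> {1..n}" for i
    proof (rule ccontr)
      assume "\<not> Z i \<omega> \<le> s"
      with \<omega> that have "(\<Sum>j\<in>{1..n}-{i}. Z j \<omega>) < n * d" "Z i \<omega> \<le> n * (e - d)" by force+
      moreover have "(\<Sum>i=1..n. Z i \<omega>) = Z i \<omega> + (\<Sum>j\<in>{1..n}-{i}. Z j \<omega>)"
        using that by (intro sum.remove) auto
      ultimately show False using \<omega>(2) by (simp add: algebra_simps)
    qed
  qed auto
  then have "prob {\<omega> \<in> space M. (\<Sum>i=1..n. Z i \<omega>) > real n * e}
      \<le> prob ((\<Union>i\<in>{1..n}. ?A i) \<union> (\<Union>i\<in>{1..n}. ?B i) \<union> ?C)"
    by (intro finite_measure_mono) auto
  also have "\<dots> \<le> prob (\<Union>i\<in>{1..n}. ?A i) + prob (\<Union>i\<in>{1..n}. ?B i) + prob ?C"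
    by (intro order_trans[OF measure_Un_le] add_mono order_refl) auto
  also have "\<dots> \<le> (\<Sum>i\<in>{1..n}. prob (?A i)) + (\<Sum>i\<in>{1..n}. prob (?B i)) + prob ?C"
    by (intro add_mono finite_measure_subadditive_finite order_refl) auto
  also have "\<dots> \<le> n * G (n * (e - d)) + n * (G s * (V / (n * d\<^sup>2))) + exp (n * (l\<^sup>2 * V * exp (l * s) - l * e))"
  proof (intro add_mono)
    show "(\<Sum>i\<in>{1..n}. prob (?A i)) \<le> n * G (n * (e - d))"
      by (subst prob_gt_ident) simp
    show "prob ?C \<le> exp (n * (l\<^sup>2 * V * exp (l * s) - l * e))"
      using truncated_chernoff[OF assms(3,4), where I = "{1..n}" and t = e] by simp
    have "prob (?B i) \<le> G s * (V / (n * d\<^sup>2))" if "i \<in> {1..n}" for i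
    proof -
      have "prob (?B i) = G s * prob {\<omega> \<in> space M. n * d \<le> \<bar>\<Sum>j\<in>{1..n}-{i}. Z j \<omega>\<bar>}"
        by (intro prob_gt_and_sum[where P = "\<lambda>x. n * d \<le> \<bar>x\<bar>"]) auto
      also have "\<dots> \<le> G s * (V / (n * d\<^sup>2))"
        by (intro mult_left_mono chebyshev_sum_others[OF assms(1,2) that] measure_nonneg)
      finally show ?thesis .
    qed
    then show "(\<Sum>i\<in>{1..n}. prob (?B i)) \<le> n * (G s * (V / (n * d\<^sup>2)))"
      using sum_bounded_above[of "{1..n}" "\<lambda>i. prob (?B i)"] by (simp only: card_n)
  qed
  finally show ?thesis by (simp only: mult.assoc)
qed

text \<open>A jump above \<open>n * (e + d)\<close> suffices when the other summands together stay
  within \<open>n * d\<close>. The last factor pays for the two ways this can fail to be counted: a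
  large fluctuation of the others, by Chebyshev, and a second jump, by a union bound.\<close>

lemma one_big_jump_lower:
  assumes "n \<ge> 1" "0 < d"
  shows "n * G (n * (e + d)) * (1 - V / (n * d\<^sup>2) - n * G (n * (e + d)))
    \<le> prob {\<omega> \<in> space M. (\<Sum>i=1..n. Z i \<omega>) > real n * e}"
proof -
  have card_n: "real (card {1..n}) = n" by simp
  let ?y = "n * (e + d)"
  let ?E = "\<lambda>i. {\<omega> \<in> space M. Z i \<omega> > ?y}"
  let ?B = "\<lambda>i. {\<omega> \<in> space M. Z i \<omega> > ?y \<and> \<not> n * d \<le> \<bar>\<Sum>j\<in>{1..n}-{i}. Z j \<omega>\<bar>}"
  \<comment> \<open>On \<open>D i\<close> the index \<open>i\<close> is the only one with a big jump; these events are disjoint.\<close>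
  define D where "D i = ?B i - (\<Union>j\<in>{1..n}-{i}. ?E j)" for i
  have [measurable]: "D i \<in> sets M" for i unfolding D_def by measurable
  have pB: "G ?y * (1 - V / (n * d\<^sup>2)) \<le> prob (?B i)" if "i \<in> {1..n}" for i
  proof -
    have "prob {\<omega> \<in> space M. \<not> n * d \<le> \<bar>\<Sum>j\<in>{1..n}-{i}. Z j \<omega>\<bar>} =
        1 - prob {\<omega> \<in> space M. n * d \<le> \<bar>\<Sum>j\<in>{1..n}-{i}. Z j \<omega>\<bar>}"
      by (rule prob_neg) measurable
    then have "G ?y * (1 - V / (n * d\<^sup>2)) \<le>
        G ?y * prob {\<omega> \<in> space M. \<not> n * d \<le> \<bar>\<Sum>j\<in>{1..n}-{i}. Z j \<omega>\<bar>}"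
      using chebyshev_sum_others[OF assms(1,2) that] by (intro mult_left_mono measure_nonneg) linarith
    also have "\<dots> = prob (?B i)"
      by (intro prob_gt_and_sum[where P = "\<lambda>x. \<not> n * d \<le> \<bar>x\<bar>", symmetric]) auto
    finally show ?thesis .
  qed
  have pEE: "prob (?B i \<inter> ?E j) \<le> G ?y * G ?y" if "i \<noteq> j" for i j
  proof -
    \<comment> \<open>Writing \<open>Z j\<close> as a sum over a singleton reduces independence of
      two jumps to \<open>prob_gt_and_sum\<close>.\<close>
    have "prob (?B i \<inter> ?E j) \<le> prob {\<omega> \<in> space M. Z i \<omega> > ?y \<and> (\<Sum>k\<in>{j}. Z k \<omega>) > ?y}"
      by (intro finite_measure_mono) auto
    also have "\<dots> = G ?y * prob {\<omega> \<in> space M. (\<Sum>k\<in>{j}. Z k \<omega>) > ?y}"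
      using that by (intro prob_gt_and_sum[where P = "\<lambda>x. x > ?y"]) auto
    finally show ?thesis by (simp add: prob_gt_ident[of ?y j])
  qed
  have pD: "G ?y * (1 - V / (n * d\<^sup>2) - n * G ?y) \<le> prob (D i)" if "i \<in> {1..n}" for i
  proof -
    have "prob (?B i) - (\<Sum>j\<in>{1..n}-{i}. prob (?B i \<inter> ?E j)) \<le> prob (?B i) - prob (\<Union>j\<in>{1..n}-{i}. ?B i \<inter> ?E j)"
      by (intro diff_left_mono finite_measure_subadditive_finite) auto
    also have "\<dots> = prob (?B i - (\<Union>j\<in>{1..n}-{i}. ?B i \<inter> ?E j))"
      by (subst finite_measure_Diff) auto
    also have "?B i - (\<Union>j\<in>{1..n}-{i}. ?B i \<inter> ?E j) = D i" by (auto simp: D_def)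
    finally have "prob (?B i) - (\<Sum>j\<in>{1..n}-{i}. prob (?B i \<inter> ?E j)) \<le> prob (D i)" .
    moreover have "(\<Sum>j\<in>{1..n}-{i}. prob (?B i \<inter> ?E j)) \<le> card ({1..n} - {i}) * (G ?y * G ?y)"
      using pEE[of i] by (intro sum_bounded_above) auto
    moreover have "card ({1..n} - {i}) * (G ?y * G ?y) \<le> n * (G ?y * G ?y)"
      using that by (intro mult_right_mono) auto
    ultimately show ?thesis using pB[OF that] by (simp add: algebra_simps)
  qed
  have "n * (G ?y * (1 - V / (n * d\<^sup>2) - n * G ?y)) \<le> (\<Sum>i\<in>{1..n}. prob (D i))"
    using sum_bounded_below[of "{1..n}", OF pD] by (simp only: card_n)
  also have "\<dots> = prob (\<Union>i\<in>{1..n}. D i)"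
    by (intro finite_measure_finite_Union[symmetric]) (auto simp: disjoint_family_on_def D_def)
  also have "\<dots> \<le> prob {\<omega> \<in> space M. (\<Sum>i=1..n. Z i \<omega>) > real n * e}"
  proof (intro finite_measure_mono subsetI)
    fix \<omega> assume "\<omega> \<in> (\<Union>i\<in>{1..n}. D i)"
    then obtain i where i: "i \<in> {1..n}" "\<omega> \<in> ?B i" unfolding D_def by blast
    have "(\<Sum>i=1..n. Z i \<omega>) = Z i \<omega> + (\<Sum>j\<in>{1..n}-{i}. Z j \<omega>)"
      using i by (intro sum.remove) auto
    with i show "\<omega> \<in> {\<omega> \<in> space M. (\<Sum>i=1..n. Z i \<omega>) > real n * e}"
      by (auto simp: algebra_simps)
  qed measurable
  finally show ?thesis by (simp only: mult.assoc)
qed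

end

section \<open>Analytic estimates for the tilt and for the control variable\<close>

text \<open>Provides an integrable majorant for difference quotients of the moment generating
  function when the variable is bounded only from above.\<close>

lemma abs_exp_minus_one_le:
  fixes y B :: real
  assumes "y \<le> B" "0 \<le> B"
  shows "\<bar>exp y - 1\<bar> \<le> \<bar>y\<bar> * exp B"
proof (cases "0 \<le> y")
  case True
  have "(1 - y) * exp y \<le> exp (- y) * exp y"
    using exp_ge_add_one_self[of "- y"] by (intro mult_right_mono) auto
  then have "exp y - 1 \<le> y * exp y" by (simp add: exp_minus algebra_simps)
  also have "\<dots> \<le> y * exp B" using True assms by (intro mult_left_mono) auto
  finally show ?thesis using True by simp
next
  case False
  then have "\<bar>exp y - 1\<bar> \<le> \<bar>y\<bar> * 1"
    using exp_ge_add_one_self[of y] exp_le_one_iff[of y] by linarith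
  also have "\<dots> \<le> \<bar>y\<bar> * exp B" using assms by (intro mult_left_mono) auto
  finally show ?thesis .
qed

text \<open>The derivative is \<open>3/4 * (z powr (-1/4) - 1)\<close>, which is nonpositive for
  \<open>z\<close> at least 1.\<close>

lemma powr_minus_linear_antimono:
  fixes x y :: real
  assumes "1 \<le> x" "x \<le> y"
  shows "y powr (3/4) - 3/4 * y \<le> x powr (3/4) - 3/4 * x"
proof (rule DERIV_nonpos_imp_nonincreasing[OF assms(2)])
  fix z assume "x \<le> z" "z \<le> y"
  then have z: "1 \<le> z" using assms by simp
  then have "((\<lambda>x. x powr (3/4) - 3/4 * x) has_real_derivative (3/4 * z powr (3/4 - 1) - 3/4)) (at z)"
    by (auto intro!: derivative_eq_intros)
  moreover have "z powr (3/4 - 1) \<le> z powr 0" using z by (intro powr_mono) auto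
  ultimately show "\<exists>d. ((\<lambda>x. x powr (3/4) - 3/4 * x) has_real_derivative d) (at z) \<and> d \<le> 0"
    using z by (intro exI[of _ "3/4 * z powr (3/4 - 1) - 3/4"]) auto
qed

text \<open>From \<open>x\<close> up to \<open>y\<close> the function decreases, but since the power
  itself increases, it loses at most the linear part \<open>3/4 * (y - x)\<close>.\<close>

lemma powr_minus_linear_lipschitz:
  fixes x y :: real
  assumes "1 \<le> x" "1 \<le> y"
  shows "\<bar>(x powr (3/4) - 3/4 * x) - (y powr (3/4) - 3/4 * y)\<bar> \<le> 3/4 * \<bar>x - y\<bar>"
proof -
  have *: "\<bar>(x powr (3/4) - 3/4 * x) - (y powr (3/4) - 3/4 * y)\<bar> \<le> 3/4 * \<bar>x - y\<bar>"
    if "1 \<le> x" "x \<le> y" for x y :: real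
  proof -
    have "x powr (3/4) \<le> y powr (3/4)" using that by (intro powr_mono2) auto
    then show ?thesis using powr_minus_linear_antimono[OF that] that by (simp add: abs_if)
  qed
  show ?thesis
    using *[of x y] *[of y x] assms by (cases "x \<le> y") (simp_all add: abs_minus_commute)
qed

section \<open>Upper deviations of variables bounded above\<close>

context iid_sequence
begin

lemma AE_ident:
  assumes [measurable]: "Measurable.pred borel P" and "AE \<omega> in M. P (Z 0 \<omega>)"
  shows "AE \<omega> in M. P (Z i \<omega>)"
proof -
  have eq: "(AE \<omega> in M. P (Z j \<omega>)) \<longleftrightarrow> (AE x in distr M borel (Z j). P x)" for j
    by (subst AE_distr_iff) auto
  show ?thesis using assms(2) unfolding eq ident[of i] .
qed

text \<open>The moment generating function has right derivative \<open>expectation (Z 0)\<close> at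
  0, which is negative, so it drops below 1 at some small positive tilt. \<open>D k\<close> is its
  difference quotient, before taking expectations, at the tilt \<open>1 / Suc k\<close>; dominated
  convergence yields the derivative.\<close>

lemma bounded_above_large_deviation:
  assumes int: "integrable M (Z 0)" and neg: "expectation (Z 0) < 0"
    and bdd: "AE \<omega> in M. Z 0 \<omega> \<le> b"
  shows "\<exists>I>0. \<forall>n. prob {\<omega> \<in> space M. 0 \<le> (\<Sum>i=1..n. Z i \<omega>)} \<le> exp (- (real n * I))"
proof -
  \<comment> \<open>A nonnegative bound survives division by every \<open>Suc k\<close>, which makes
    the majorant uniform in \<open>k\<close>.\<close>
  define B where "B = max b 0"
  have bdd: "AE \<omega> in M. Z 0 \<omega> \<le> B" and "0 \<le> B" using bdd by (auto simp: B_def)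
  define D where "D k x = (exp (x / real (Suc k)) - 1) * real (Suc k)" for k and x :: real
  have [measurable]: "D k \<in> borel_measurable borel" for k unfolding D_def by measurable
  have D_bound: "\<bar>D k x\<bar> \<le> \<bar>x\<bar> * exp B" if "x \<le> B" for k x
  proof -
    have "x \<le> B * real (Suc k)"
      using that mult_left_mono[of 1 "real (Suc k)" B] \<open>0 \<le> B\<close> by simp
    then have "\<bar>exp (x / real (Suc k)) - 1\<bar> \<le> \<bar>x / real (Suc k)\<bar> * exp B"
      using \<open>0 \<le> B\<close> by (intro abs_exp_minus_one_le) (auto simp: field_simps)
    then have "\<bar>exp (x / real (Suc k)) - 1\<bar> * real (Suc k) \<le> \<bar>x / real (Suc k)\<bar> * exp B * real (Suc k)"
      by (rule mult_right_mono) simp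
    also have "\<dots> = \<bar>x\<bar> * exp B" by (simp del: of_nat_Suc)
    finally show ?thesis by (simp add: D_def abs_mult del: of_nat_Suc)
  qed
  have D_lim: "(\<lambda>k. D k x) \<longlonglongrightarrow> x" for x
  proof -
    have "((\<lambda>h. (exp (x * h) - 1) / h) \<longlongrightarrow> x) (at 0)"
    proof -
      have "((\<lambda>h. exp (x * h)) has_real_derivative x) (at 0)" by (auto intro!: derivative_eq_intros)
      then show ?thesis by (simp add: DERIV_def)
    qed
    moreover have "filterlim (\<lambda>k. inverse (real (Suc k))) (at 0) sequentially"
      using LIMSEQ_inverse_real_of_nat by (auto simp: filterlim_at simp del: of_nat_Suc)
    ultimately have "(\<lambda>k. (exp (x * inverse (real (Suc k))) - 1) / inverse (real (Suc k))) \<longlonglongrightarrow> x"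
      by (rule filterlim_compose)
    then show ?thesis by (simp add: D_def divide_inverse)
  qed
  have "(\<lambda>k. expectation (\<lambda>\<omega>. D k (Z 0 \<omega>))) \<longlonglongrightarrow> expectation (Z 0)"
  proof (rule integral_dominated_convergence[where w = "\<lambda>\<omega>. \<bar>Z 0 \<omega>\<bar> * exp B"])
    show "integrable M (\<lambda>\<omega>. \<bar>Z 0 \<omega>\<bar> * exp B)" using int by simp
    show "AE \<omega> in M. norm (D k (Z 0 \<omega>)) \<le> \<bar>Z 0 \<omega>\<bar> * exp B" for k
      using bdd by eventually_elim (simp add: D_bound)
  qed (auto intro: D_lim)
  then have "\<forall>\<^sub>F k in sequentially. expectation (\<lambda>\<omega>. D k (Z 0 \<omega>)) < 0"
    using neg by (rule order_tendstoD(2))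
  then obtain k where k: "expectation (\<lambda>\<omega>. D k (Z 0 \<omega>)) < 0"
    using eventually_happens'[OF sequentially_bot] by blast
  define w where "w x = exp (x / real (Suc k))" for x :: real
  have [measurable]: "w \<in> borel_measurable borel" unfolding w_def by measurable
  have iw: "integrable M (\<lambda>\<omega>. w (Z 0 \<omega>))"
  proof (rule integrable_const_bound)
    show "AE \<omega> in M. norm (w (Z 0 \<omega>)) \<le> exp (B / real (Suc k))"
      using bdd by eventually_elim (simp add: w_def divide_right_mono)
  qed simp
  define \<phi> where "\<phi> = expectation (\<lambda>\<omega>. w (Z 0 \<omega>))"
  have "expectation (\<lambda>\<omega>. D k (Z 0 \<omega>)) = (\<phi> - 1) * real (Suc k)"
    using iw unfolding D_def \<phi>_def w_def[symmetric] by (simp add: prob_space)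
  then have "\<phi> < 1" using k by (simp add: mult_less_0_iff)
  have "0 \<le> \<phi>" unfolding \<phi>_def by (intro integral_nonneg_AE) (simp add: w_def)
  have "prob {\<omega> \<in> space M. 0 \<le> (\<Sum>i=1..n. Z i \<omega>)} \<le> exp (- (real n * (1 - \<phi>)))" for n
  proof -
    have "(\<Prod>i=1..n. w (Z i \<omega>)) = exp ((\<Sum>i=1..n. Z i \<omega>) / real (Suc k))" for \<omega>
      by (simp only: w_def exp_sum[symmetric] sum_divide_distrib finite_atLeastAtMost)
    then have "prob {\<omega> \<in> space M. 0 \<le> (\<Sum>i=1..n. Z i \<omega>)} = prob {\<omega> \<in> space M. 1 \<le> (\<Prod>i=1..n. w (Z i \<omega>))}"
      by (simp add: zero_le_divide_iff)
    also have "\<dots> \<le> \<phi> ^ card {1..n}"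
      unfolding \<phi>_def by (rule prob_prod_ge_one) (use iw in \<open>auto simp: w_def\<close>)
    \<comment> \<open>The inequality \<open>\<phi> \<le> exp (\<phi> - 1)\<close> gives the rate
      \<open>1 - \<phi>\<close> without a logarithm.\<close>
    also have "\<dots> \<le> exp (\<phi> - 1) ^ card {1..n}"
      using exp_ge_add_one_self[of "\<phi> - 1"] \<open>0 \<le> \<phi>\<close> by (intro power_mono) auto
    finally show ?thesis by (simp add: exp_of_nat_mult[symmetric] algebra_simps)
  qed
  then show ?thesis using \<open>\<phi> < 1\<close> by (intro exI[of _ "1 - \<phi>"]) auto
qed

end

context centered_iid_sequence
begin

text \<open>The truncation condition holds almost surely, so it can be inserted for free.\<close>

lemma bounded_above_chernoff:
  assumes bdd: "AE \<omega> in M. Z 0 \<omega> \<le> b" and "0 \<le> l" "0 \<le> b"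
  shows "prob {\<omega> \<in> space M. real n * t \<le> (\<Sum>i=1..n. Z i \<omega>)}
    \<le> exp (real n * (l\<^sup>2 * V * exp (l * b) - l * t))"
proof -
  have "AE \<omega> in M. \<forall>i. Z i \<omega> \<le> b"
    using AE_ident[of "\<lambda>x. x \<le> b"] bdd by (simp add: AE_all_countable)
  then have "prob {\<omega> \<in> space M. real n * t \<le> (\<Sum>i=1..n. Z i \<omega>)} =
      prob {\<omega> \<in> space M. real (card {1..n}) * t \<le> (\<Sum>i\<in>{1..n}. Z i \<omega>) \<and> (\<forall>i\<in>{1..n}. Z i \<omega> \<le> b)}"
    by (intro finite_measure_eq_AE) auto
  also have "\<dots> \<le> exp (real (card {1..n}) * (l\<^sup>2 * V * exp (l * b) - l * t))"
    using assms by (intro truncated_chernoff) auto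
  finally show ?thesis by simp
qed

text \<open>Disposes of thresholds too large for a Chernoff bound with a small tilt.\<close>

lemma prob_sum_above_bound:
  assumes bdd: "AE \<omega> in M. Z 0 \<omega> \<le> b" and "b < t" "n \<ge> 1"
  shows "prob {\<omega> \<in> space M. real n * t \<le> (\<Sum>i=1..n. Z i \<omega>)} = 0"
proof -
  have "AE \<omega> in M. \<forall>i. Z i \<omega> \<le> b"
    using AE_ident[of "\<lambda>x. x \<le> b"] bdd by (simp add: AE_all_countable)
  then have "AE \<omega> in M. \<not> real n * t \<le> (\<Sum>i=1..n. Z i \<omega>)"
  proof eventually_elim
    case (elim \<omega>)
    then have "(\<Sum>i=1..n. Z i \<omega>) \<le> real (card {1..n}) * b" by (intro sum_bounded_above) auto
    also have "\<dots> < real n * t" using assms by simp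
    finally show ?case by simp
  qed
  then show ?thesis by (simp add: prob_eq_0)
qed

end

text \<open>The second moment about \<open>c\<close> exceeds the variance by the square of
  \<open>expectation W - c\<close>.\<close>

lemma (in prob_space) variance_le_second_moment:
  fixes W :: "'a \<Rightarrow> real"
  assumes "integrable M W" "integrable M (\<lambda>\<omega>. (W \<omega> - c)\<^sup>2)"
  shows "variance W \<le> expectation (\<lambda>\<omega>. (W \<omega> - c)\<^sup>2)"
proof -
  have *: "(W \<omega> - expectation W)\<^sup>2 = (W \<omega> - c)\<^sup>2 - 2 * (expectation W - c) * (W \<omega> - c) + (expectation W - c)\<^sup>2" for \<omega>
    by (simp add: power2_eq_square algebra_simps)
  have "variance W = expectation (\<lambda>\<omega>. (W \<omega> - c)\<^sup>2) - 2 * (expectation W - c) * (expectation W - c) + (expectation W - c)\<^sup>2"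
    unfolding * using assms by (simp add: prob_space)
  also have "2 * (expectation W - c) * (expectation W - c) = 2 * (expectation W - c)\<^sup>2"
    by (simp add: power2_eq_square)
  finally show ?thesis using zero_le_power2[of "expectation W - c"] by linarith
qed

section \<open>Sharp asymptotics for a power tail\<close>

context centered_iid_sequence
begin

text \<open>After scaling by \<open>n powr (\<alpha> - 1)\<close>, the finite-sample bounds tend to
  \<open>(e + d) powr - \<alpha>\<close> and \<open>(e - d) powr - \<alpha>\<close>. Since
  \<open>d\<close> is arbitrarily small, the scaled probability \<open>R\<close> converges to
  \<open>e powr - \<alpha>\<close>.\<close>

theorem one_big_jump:
  assumes "1 < \<alpha>" and tail: "((\<lambda>y. y powr \<alpha> * G y) \<longlongrightarrow> 1) at_top" and "0 < e"
  shows "(\<lambda>n. prob {\<omega> \<in> space M. (\<Sum>i=1..n. Z i \<omega>) > real n * e})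
    \<sim>[sequentially] (\<lambda>n. real n * (real n * e) powr - \<alpha>)"
proof -
  define P where "P n = prob {\<omega> \<in> space M. (\<Sum>i=1..n. Z i \<omega>) > real n * e}" for n :: nat
  define R where "R n = real n powr (\<alpha> - 1) * P n" for n :: nat
  have tail_n: "(\<lambda>n. real n powr \<alpha> * G (real n * a)) \<longlonglongrightarrow> a powr - \<alpha>" if "0 < a" for a
  proof -
    have "filterlim (\<lambda>n. real n * a) at_top sequentially" using that by real_asymp
    from tendsto_mult[OF filterlim_compose[OF tail this] tendsto_const[of "a powr - \<alpha>"]]
    have "(\<lambda>n. (real n * a) powr \<alpha> * G (real n * a) * a powr - \<alpha>) \<longlonglongrightarrow> a powr - \<alpha>" by simp
    then show ?thesis
      using that by (simp add: powr_mult powr_minus field_simps)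
  qed
  have lower: "\<forall>\<^sub>F n in sequentially. x < R n" if x: "x < e powr - \<alpha>" for x
  proof -
    have "((\<lambda>d. (e + d) powr - \<alpha>) \<longlongrightarrow> (e + 0) powr - \<alpha>) (at_right 0)"
      using \<open>0 < e\<close> by (intro tendsto_intros) auto
    then have "\<forall>\<^sub>F d in at_right 0. x < (e + d) powr - \<alpha>"
      using x by (intro order_tendstoD(1)) auto
    then obtain d where d: "0 < d" "x < (e + d) powr - \<alpha>" by (rule eventually_at_right_zeroE)
    define Q where "Q n = real n powr \<alpha> * G (real n * (e + d))" for n :: nat
    have Q: "Q \<longlonglongrightarrow> (e + d) powr - \<alpha>" unfolding Q_def using d \<open>0 < e\<close> by (intro tail_n) simp
    have "(\<lambda>n. V * (1 / (real n * d\<^sup>2))) \<longlonglongrightarrow> V * 0"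
      using d by (intro tendsto_mult tendsto_const) real_asymp
    then have z1: "(\<lambda>n. V / (real n * d\<^sup>2)) \<longlonglongrightarrow> 0" by simp
    \<comment> \<open>The chance of a second jump is bounded by \<open>n * G (n * (e + d))\<close>,
      which is \<open>n powr (1 - \<alpha>) * Q n\<close>; it vanishes as
      \<open>\<alpha> > 1\<close>.\<close>
    have z2: "(\<lambda>n. real n powr (1 - \<alpha>)) \<longlonglongrightarrow> 0" using \<open>1 < \<alpha>\<close> by real_asymp
    have "(\<lambda>n. Q n * (1 - V / (real n * d\<^sup>2) - real n powr (1 - \<alpha>) * Q n)) \<longlonglongrightarrow>
        (e + d) powr - \<alpha> * (1 - 0 - 0 * (e + d) powr - \<alpha>)"
      by (intro tendsto_mult tendsto_diff tendsto_const Q z1 z2)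
    then have "\<forall>\<^sub>F n in sequentially. x < Q n * (1 - V / (real n * d\<^sup>2) - real n powr (1 - \<alpha>) * Q n)"
      using d by (intro order_tendstoD(1)) auto
    then show ?thesis using eventually_ge_at_top[of 1]
    proof eventually_elim
      case (elim n)
      have p: "real n powr (\<alpha> - 1) * real n = real n powr \<alpha>" "real n powr (1 - \<alpha>) * real n powr \<alpha> = real n"
        using elim(2) by (simp add: powr_diff) (use elim(2) in \<open>simp flip: powr_add\<close>)
      have "Q n * (1 - V / (real n * d\<^sup>2) - real n powr (1 - \<alpha>) * Q n) =
          real n powr (\<alpha> - 1) * (real n * G (n * (e + d)) * (1 - V / (n * d\<^sup>2) - n * G (n * (e + d))))"
        unfolding Q_def using p by (simp add: mult.assoc[symmetric])
      also have "\<dots> \<le> R n"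
        unfolding R_def P_def by (intro mult_left_mono one_big_jump_lower elim(2) d(1)) simp
      finally show ?case using elim(1) by simp
    qed
  qed
  have upper: "\<forall>\<^sub>F n in sequentially. R n < x" if x: "e powr - \<alpha> < x" for x
  proof -
    have "((\<lambda>d. (e - d) powr - \<alpha>) \<longlongrightarrow> (e - 0) powr - \<alpha>) (at_right 0)"
      using \<open>0 < e\<close> by (intro tendsto_intros) auto
    then have "\<forall>\<^sub>F d in at_right 0. (e - d) powr - \<alpha> < x"
      using x by (intro order_tendstoD(2)) auto
    moreover have "\<forall>\<^sub>F d in at_right 0. d < e"
      using \<open>0 < e\<close> by (intro order_tendstoD(2)[OF tendsto_ident_at]) auto
    ultimately have "\<forall>\<^sub>F d in at_right 0. (e - d) powr - \<alpha> < x \<and> d < e" by (rule eventually_conj)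
    then obtain d where d: "0 < d" "d < e" "(e - d) powr - \<alpha> < x" using eventually_at_right_zeroE by blast
    \<comment> \<open>The tilt \<open>l = c ln n / n\<close> gives \<open>exp (- n l e) = n powr - \<alpha>\<close>, and truncating at \<open>n s\<close> keeps
      \<open>exp (l n s) = sqrt n\<close>, small enough for the variance term to vanish.\<close>
    define c where "c = \<alpha> / e"
    define s where "s = 1 / (2 * c)"
    have cs: "0 < c" "0 < s" "c * e = \<alpha>" "c * s = 1/2" using assms by (auto simp: c_def s_def)
    define Q where "Q a n = real n powr \<alpha> * G (real n * a)" for a and n :: nat
    have Q: "Q (e - d) \<longlonglongrightarrow> (e - d) powr - \<alpha>" "Q s \<longlonglongrightarrow> s powr - \<alpha>"
      unfolding Q_def by (rule tail_n, use d(2) cs(2) in simp)+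
    have "(\<lambda>n. V * (1 / (real n * d\<^sup>2))) \<longlonglongrightarrow> V * 0"
      using d by (intro tendsto_mult tendsto_const) real_asymp
    then have z1: "(\<lambda>n. V / (real n * d\<^sup>2)) \<longlonglongrightarrow> 0" by simp
    have "(\<lambda>n. c\<^sup>2 * V * ((ln (real n))\<^sup>2 * real n powr (-1/2))) \<longlonglongrightarrow> c\<^sup>2 * V * 0"
      by (intro tendsto_mult tendsto_const) real_asymp
    then have "(\<lambda>n. exp (c\<^sup>2 * V * ((ln (real n))\<^sup>2 * real n powr (-1/2)))) \<longlonglongrightarrow> exp 0"
      by (intro tendsto_exp) simp
    then have z2: "(\<lambda>n. inverse (real n) * exp (c\<^sup>2 * V * ((ln (real n))\<^sup>2 * real n powr (-1/2)))) \<longlonglongrightarrow> 0 * exp 0"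
      by (intro tendsto_mult) (real_asymp, simp)
    have "(\<lambda>n. Q (e - d) n + Q s n * (V / (real n * d\<^sup>2)) +
        inverse (real n) * exp (c\<^sup>2 * V * ((ln (real n))\<^sup>2 * real n powr (-1/2)))) \<longlonglongrightarrow>
        (e - d) powr - \<alpha> + s powr - \<alpha> * 0 + 0 * exp 0"
      by (intro tendsto_mult tendsto_add Q z1 z2)
    then have "\<forall>\<^sub>F n in sequentially. Q (e - d) n + Q s n * (V / (real n * d\<^sup>2)) +
        inverse (real n) * exp (c\<^sup>2 * V * ((ln (real n))\<^sup>2 * real n powr (-1/2))) < x"
      using d by (intro order_tendstoD(2)) auto
    then show ?thesis using eventually_ge_at_top[of 1]
    proof eventually_elim
      case (elim n)
      define l where "l = c * ln (real n) / real n"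
      have n: "0 < real n" using elim(2) by simp
      have l: "0 \<le> l" using elim(2) cs by (simp add: l_def)
      have p: "real n powr (\<alpha> - 1) * real n = real n powr \<alpha>"
        using n by (simp add: powr_diff)
      have "l * (real n * s) = c * s * ln (real n)" using n by (simp add: l_def)
      then have ls: "exp (l * (real n * s)) = real n powr (1/2)" using n cs by (simp add: powr_def)
      have "real n * (l\<^sup>2 * V * real n powr (1/2)) = c\<^sup>2 * V * (ln (real n))\<^sup>2 * (real n powr (1/2) / real n)"
        using n by (simp add: l_def power2_eq_square field_simps)
      also have "real n powr (1/2) / real n = real n powr (1/2 - 1)"
        using n by (simp only: powr_diff powr_one)
      finally have h: "real n * (l\<^sup>2 * V * real n powr (1/2)) = c\<^sup>2 * V * (ln (real n))\<^sup>2 * real n powr (1/2 - 1)" .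
      have "real n * (l * e) = \<alpha> * ln (real n)" using n by (simp add: l_def flip: cs(3))
      then have "real n * (l\<^sup>2 * V * exp (l * (real n * s)) - l * e) =
          c\<^sup>2 * V * ((ln (real n))\<^sup>2 * real n powr (-1/2)) - \<alpha> * ln (real n)"
        unfolding ls right_diff_distrib h by simp
      \<comment> \<open>The scaling \<open>n powr (\<alpha> - 1)\<close> meets
        \<open>n powr - \<alpha>\<close> from the tilt and leaves \<open>1 / n\<close>, times an
        exponential that tends to 1.\<close>
      then have "real n powr (\<alpha> - 1) * exp (real n * (l\<^sup>2 * V * exp (l * (real n * s)) - l * e)) =
          exp ((\<alpha> - 1) * ln (real n) + (c\<^sup>2 * V * ((ln (real n))\<^sup>2 * real n powr (-1/2)) - \<alpha> * ln (real n)))"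
        using n by (simp only: exp_add) (simp add: powr_def)
      also have "\<dots> = exp (- ln (real n)) * exp (c\<^sup>2 * V * ((ln (real n))\<^sup>2 * real n powr (-1/2)))"
        unfolding exp_add[symmetric] by (simp add: algebra_simps)
      also have "exp (- ln (real n)) = inverse (real n)" using n by (simp add: exp_minus)
      finally have E: "real n powr (\<alpha> - 1) * exp (real n * (l\<^sup>2 * V * exp (l * (real n * s)) - l * e)) =
        inverse (real n) * exp (c\<^sup>2 * V * ((ln (real n))\<^sup>2 * real n powr (-1/2)))" .
      have "R n \<le> real n powr (\<alpha> - 1) * (n * G (n * (e - d)) + n * G (n * s) * (V / (n * d\<^sup>2))
          + exp (n * (l\<^sup>2 * V * exp (l * (n * s)) - l * e)))"
        unfolding R_def P_def
        by (intro mult_left_mono one_big_jump_upper elim(2) d(1) l) (use cs in auto)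
      also have "\<dots> = Q (e - d) n + Q s n * (V / (real n * d\<^sup>2)) +
        inverse (real n) * exp (c\<^sup>2 * V * ((ln (real n))\<^sup>2 * real n powr (-1/2)))"
        unfolding distrib_left E Q_def by (simp only: mult.assoc[symmetric] p)
      finally show ?case using elim(1) by simp
    qed
  qed
  have "R \<longlonglongrightarrow> e powr - \<alpha>" using lower upper by (rule order_tendstoI)
  then have "(\<lambda>n. R n / e powr - \<alpha>) \<longlonglongrightarrow> e powr - \<alpha> / e powr - \<alpha>"
    by (intro tendsto_divide tendsto_const) (use \<open>0 < e\<close> in auto)
  then have R1: "(\<lambda>n. R n / e powr - \<alpha>) \<longlonglongrightarrow> 1" using \<open>0 < e\<close> by simp
  have "(\<lambda>n. P n / (real n * (real n * e) powr - \<alpha>)) \<longlonglongrightarrow> 1"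
  proof (rule Lim_transform_eventually[OF R1])
    show "\<forall>\<^sub>F n in sequentially. R n / e powr - \<alpha> = P n / (real n * (real n * e) powr - \<alpha>)"
      using eventually_gt_at_top[of 0]
      by eventually_elim (use \<open>0 < e\<close> in \<open>simp add: R_def powr_mult powr_diff powr_minus field_simps\<close>)
  qed
  then show ?thesis unfolding P_def by (rule asymp_equivI')
qed

end

section \<open>Joint deviations with the control variable\<close>

context iid_sequence
begin

lemma integrable_three_quarters_power:
  assumes ge1: "AE \<omega> in M. 1 \<le> Z 0 \<omega>" and int: "integrable M (Z 0)"
  shows "integrable M (\<lambda>\<omega>. Z 0 \<omega> powr (3/4))"
proof (rule Bochner_Integration.integrable_bound[OF int])
  show "AE \<omega> in M. norm (Z 0 \<omega> powr (3/4)) \<le> norm (Z 0 \<omega>)"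
    using ge1
  proof eventually_elim
    case (elim \<omega>)
    then have "Z 0 \<omega> powr (3/4) \<le> Z 0 \<omega> powr 1" by (intro powr_mono) auto
    then show ?case using elim by simp
  qed
qed simp

text \<open>With variance at most 5/4 and the exponential correction at most 6/5, the tilt
  \<open>2/5 * t\<close> gives the exponent \<open>- 4/25 * t^2\<close> per sample. For
  \<open>t = 77/80 * \<epsilon>\<close> the coefficient of \<open>\<epsilon>^2\<close> is about
  0.148, well above 0.0367.\<close>

lemma three_quarters_power_joint_deviation:
  assumes ge1: "AE \<omega> in M. 1 \<le> Z 0 \<omega>"
    and mean: "expectation (Z 0) = 5/3" and var: "variance (Z 0) = 20/9"
    and \<mu>: "\<mu> = expectation (\<lambda>\<omega>. Z 0 \<omega> powr (3/4))"
    and "0 < \<epsilon>" "u \<le> \<epsilon> / 20" "n \<ge> 1"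
  shows "prob {\<omega> \<in> space M. S_hat Z n \<omega> - \<mu> > \<epsilon> \<and> \<bar>T_hat Z n \<omega> - 5/3\<bar> < u}
    \<le> exp (- (0.0367 * real n * \<epsilon>\<^sup>2))"
proof -
  \<comment> \<open>\<open>3/4\<close> is the least weight for which \<open>h\<close> decreases on \<open>[1, \<infinity>)\<close>, hence is bounded above by \<open>h 1 = 1/4\<close>.\<close>
  define h where "h x = x powr (3/4) - 3/4 * x" for x :: real
  define g where "g x = h x - (\<mu> - 5/4)" for x
  have [measurable]: "h \<in> borel_measurable borel" "g \<in> borel_measurable borel"
    unfolding h_def g_def by measurable
  \<comment> \<open>A nonzero Bochner integral forces integrability; the same argument applies to
    the variance next.\<close>
  have int: "integrable M (Z 0)" using mean not_integrable_integral_eq by fastforce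
  have int_sq: "integrable M (\<lambda>\<omega>. (Z 0 \<omega> - 5/3)\<^sup>2)"
    using var not_integrable_integral_eq unfolding mean by fastforce
  have intY: "integrable M (\<lambda>\<omega>. Z 0 \<omega> powr (3/4))"
    using ge1 int by (rule integrable_three_quarters_power)
  have "expectation (\<lambda>_. 1) \<le> expectation (\<lambda>\<omega>. Z 0 \<omega> powr (3/4))"
    by (intro integral_mono_AE intY) (use ge1 in \<open>auto intro: ge_one_powr_ge_zero elim!: eventually_mono\<close>)
  then have "1 \<le> \<mu>" by (simp add: \<mu> prob_space)
  have inth: "integrable M (\<lambda>\<omega>. h (Z 0 \<omega>))" unfolding h_def using int intY by simp
  have Eh: "expectation (\<lambda>\<omega>. h (Z 0 \<omega>)) = \<mu> - 5/4" unfolding h_def using int intY mean \<mu> by simp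
  have lip: "AE \<omega> in M. (h (Z 0 \<omega>) - h (5/3))\<^sup>2 \<le> 9/16 * (Z 0 \<omega> - 5/3)\<^sup>2"
    using ge1
  proof eventually_elim
    case (elim \<omega>)
    then have "\<bar>h (Z 0 \<omega>) - h (5/3)\<bar> \<le> 3/4 * \<bar>Z 0 \<omega> - 5/3\<bar>"
      unfolding h_def by (intro powr_minus_linear_lipschitz) auto
    then have "\<bar>h (Z 0 \<omega>) - h (5/3)\<bar>\<^sup>2 \<le> (3/4 * \<bar>Z 0 \<omega> - 5/3\<bar>)\<^sup>2" by (intro power_mono) auto
    then show ?case by (simp add: power_mult_distrib power2_eq_square)
  qed
  have int_lip: "integrable M (\<lambda>\<omega>. 9/16 * (Z 0 \<omega> - 5/3)\<^sup>2)" using int_sq by simp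
  have inth_sq: "integrable M (\<lambda>\<omega>. (h (Z 0 \<omega>) - h (5/3))\<^sup>2)"
    by (rule Bochner_Integration.integrable_bound[OF int_lip]) (use lip in auto)
  \<comment> \<open>The Lipschitz bound controls deviations from \<open>h (5/3)\<close>, not from
    the mean \<open>\<mu> - 5/4\<close> of \<open>h\<close>; expanding about \<open>h (5/3)\<close>
    transfers square integrability.\<close>
  have g_sq: "(g x)\<^sup>2 = (h x - h (5/3))\<^sup>2 + 2 * (h (5/3) - (\<mu> - 5/4)) * (h x - h (5/3)) + (h (5/3) - (\<mu> - 5/4))\<^sup>2" for x
    by (simp add: g_def power2_eq_square algebra_simps)
  interpret g: iid_sequence M "\<lambda>i \<omega>. g (Z i \<omega>)" by (rule iid_sequence_compose) simp
  interpret g: centered_iid_sequence M "\<lambda>i \<omega>. g (Z i \<omega>)"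
  proof
    show "integrable M (\<lambda>\<omega>. g (Z 0 \<omega>))" unfolding g_def using inth by simp
    show "integrable M (\<lambda>\<omega>. (g (Z 0 \<omega>))\<^sup>2)" unfolding g_sq using inth inth_sq by simp
    show "expectation (\<lambda>\<omega>. g (Z 0 \<omega>)) = 0" unfolding g_def using inth Eh by (simp add: prob_space)
  qed
  have "g.V = variance (\<lambda>\<omega>. h (Z 0 \<omega>))" unfolding g_def Eh ..
  also have "\<dots> \<le> expectation (\<lambda>\<omega>. (h (Z 0 \<omega>) - h (5/3))\<^sup>2)"
    by (rule variance_le_second_moment[OF inth inth_sq])
  also have "\<dots> \<le> expectation (\<lambda>\<omega>. 9/16 * (Z 0 \<omega> - 5/3)\<^sup>2)"
    by (rule integral_mono_AE[OF inth_sq int_lip lip])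
  also have "\<dots> = 5/4" using var unfolding mean by simp
  finally have V: "g.V \<le> 5/4" .
  \<comment> \<open>Here \<open>h\<close> is at most \<open>h 1 = 1/4\<close> and
    \<open>\<mu>\<close> is at least 1, so \<open>g\<close> is at most
    \<open>1/4 - 1 + 5/4\<close>.\<close>
  have bdd: "AE \<omega> in M. g (Z 0 \<omega>) \<le> 1/2"
    using ge1
  proof eventually_elim
    case (elim \<omega>)
    then show ?case
      using powr_minus_linear_antimono[of 1 "Z 0 \<omega>"] \<open>1 \<le> \<mu>\<close> by (simp add: g_def h_def)
  qed
  \<comment> \<open>The factor is \<open>1 - 3/4 * 1/20\<close>: the control variable costs at most
    \<open>3/4 * u\<close>.\<close>
  define t where "t = 77/80 * \<epsilon>"
  have "0 < t" using \<open>0 < \<epsilon>\<close> by (simp add: t_def)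
  have "prob {\<omega> \<in> space M. S_hat Z n \<omega> - \<mu> > \<epsilon> \<and> \<bar>T_hat Z n \<omega> - 5/3\<bar> < u}
      \<le> prob {\<omega> \<in> space M. real n * t \<le> (\<Sum>i=1..n. g (Z i \<omega>))}"
  proof (intro finite_measure_mono subsetI)
    fix \<omega> assume "\<omega> \<in> {\<omega> \<in> space M. S_hat Z n \<omega> - \<mu> > \<epsilon> \<and> \<bar>T_hat Z n \<omega> - 5/3\<bar> < u}"
    then have \<omega>: "\<omega> \<in> space M" "S_hat Z n \<omega> - \<mu> > \<epsilon>" "T_hat Z n \<omega> - 5/3 < u" by auto
    have "(\<Sum>i=1..n. g (Z i \<omega>)) = (\<Sum>i=1..n. Z i \<omega> powr (3/4)) - 3/4 * (\<Sum>i=1..n. Z i \<omega>) - real n * (\<mu> - 5/4)"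
      by (simp add: g_def h_def sum_subtractf sum_distrib_left)
    also have "\<dots> = real n * (S_hat Z n \<omega> - 3/4 * T_hat Z n \<omega> - (\<mu> - 5/4))"
      using \<open>n \<ge> 1\<close> by (simp add: S_hat_def T_hat_def algebra_simps)
    finally have s: "(\<Sum>i=1..n. g (Z i \<omega>)) = real n * (S_hat Z n \<omega> - 3/4 * T_hat Z n \<omega> - (\<mu> - 5/4))" .
    have "t \<le> S_hat Z n \<omega> - 3/4 * T_hat Z n \<omega> - (\<mu> - 5/4)"
      using \<omega> \<open>u \<le> \<epsilon> / 20\<close> by (simp add: t_def)
    then have "real n * t \<le> (\<Sum>i=1..n. g (Z i \<omega>))"
      unfolding s by (rule mult_left_mono) simp
    then show "\<omega> \<in> {\<omega> \<in> space M. real n * t \<le> (\<Sum>i=1..n. g (Z i \<omega>))}"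
      using \<omega>(1) by simp
  qed measurable
  also have "\<dots> \<le> exp (- (0.0367 * real n * \<epsilon>\<^sup>2))"
  proof (cases "t \<le> 1/2")
    case False
    then show ?thesis using g.prob_sum_above_bound[OF bdd, of t n] \<open>n \<ge> 1\<close> by simp
  next
    case True
    \<comment> \<open>the minimiser of \<open>l\<^sup>2 * (5/4) - l * t\<close>\<close>
    define l where "l = 2/5 * t"
    \<comment> \<open>Here \<open>l / 2 = t / 5\<close>, and \<open>t\<close> is at most 1/2. The
      bound 6/5 then follows from \<open>exp (1/10) \<le> 10/9\<close>.\<close>
    have "exp (l * (1/2)) \<le> exp (1/10)" using True by (simp add: l_def)
    also have "\<dots> \<le> 6/5"
    proof -
      have "9/10 \<le> exp (- (1/10 :: real))" using exp_ge_add_one_self[of "- (1/10 :: real)"] by simp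
      then show ?thesis by (simp add: exp_minus field_simps)
    qed
    finally have "l\<^sup>2 * g.V * exp (l * (1/2)) \<le> l\<^sup>2 * (5/4) * (6/5)"
      using V by (intro mult_mono) auto
    moreover have "l\<^sup>2 * (5/4) * (6/5) - l * t = - (4/25 * (77/80)\<^sup>2 * \<epsilon>\<^sup>2)"
      by (simp add: l_def t_def power2_eq_square)
    moreover have "0.0367 * \<epsilon>\<^sup>2 \<le> 4/25 * (77/80)\<^sup>2 * \<epsilon>\<^sup>2"
      by (intro mult_right_mono) (simp_all add: power2_eq_square)
    ultimately have "l\<^sup>2 * g.V * exp (l * (1/2)) - l * t \<le> - (0.0367 * \<epsilon>\<^sup>2)"
      by linarith
    then have "real n * (l\<^sup>2 * g.V * exp (l * (1/2)) - l * t) \<le> real n * (- (0.0367 * \<epsilon>\<^sup>2))"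
      by (rule mult_left_mono) simp
    then have "exp (real n * (l\<^sup>2 * g.V * exp (l * (1/2)) - l * t)) \<le> exp (- (0.0367 * real n * \<epsilon>\<^sup>2))"
      by (simp add: mult_ac)
    moreover have "prob {\<omega> \<in> space M. real n * t \<le> (\<Sum>i=1..n. g (Z i \<omega>))}
        \<le> exp (real n * (l\<^sup>2 * g.V * exp (l * (1/2)) - l * t))"
      using \<open>0 < t\<close> by (intro g.bounded_above_chernoff[OF bdd]) (simp_all add: l_def)
    ultimately show ?thesis by (rule order_trans[rotated])
  qed
  finally show ?thesis .
qed

text \<open>On the event the sum of the \<open>g (Z i)\<close> is nonnegative, although each term
  has negative mean and is bounded above because a line of positive slope outgrows the power
  3/4.\<close>

lemma joint_deviation_exponential:
  assumes ge1: "AE \<omega> in M. 1 \<le> Z 0 \<omega>"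
    and mean: "expectation (Z 0) = 5/3"
    and \<mu>: "\<mu> = expectation (\<lambda>\<omega>. Z 0 \<omega> powr (3/4))"
    and "0 < \<epsilon>" "0 < u"
  shows "\<exists>I>0. \<forall>n\<ge>1. prob {\<omega> \<in> space M. S_hat Z n \<omega> - \<mu> > \<epsilon> \<and> \<bar>T_hat Z n \<omega> - 5/3\<bar> < u}
    \<le> exp (- (real n * I))"
proof -
  \<comment> \<open>This weight makes the mean of \<open>g\<close> equal to
    \<open>- \<epsilon> + \<eta> * u = - \<epsilon> / 2\<close>. Any positive weight below
    \<open>\<epsilon> / u\<close> would keep it negative.\<close>
  define \<eta> where "\<eta> = \<epsilon> / (2 * u)"
  have "0 < \<eta>" "\<eta> * u = \<epsilon> / 2" using assms by (auto simp: \<eta>_def)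
  define g where "g x = (x powr (3/4) - \<mu> - \<epsilon>) - \<eta> * (x - 5/3 - u)" for x :: real
  have [measurable]: "g \<in> borel_measurable borel" unfolding g_def by measurable
  have int: "integrable M (Z 0)" using mean not_integrable_integral_eq by fastforce
  have intY: "integrable M (\<lambda>\<omega>. Z 0 \<omega> powr (3/4))"
    using ge1 int by (rule integrable_three_quarters_power)
  interpret g: iid_sequence M "\<lambda>i \<omega>. g (Z i \<omega>)" by (rule iid_sequence_compose) simp
  \<comment> \<open>\<open>x powr (3/4)\<close> and \<open>\<eta> * x\<close> cross at \<open>x = \<eta> powr - 4\<close>, where both equal \<open>\<eta> powr - 3\<close>.\<close>
  define b where "b = \<eta> powr - 3 - \<mu> - \<epsilon> + \<eta> * (5/3 + u)"
  have "AE \<omega> in M. g (Z 0 \<omega>) \<le> b"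
    using ge1
  proof eventually_elim
    case (elim \<omega>)
    let ?x = "Z 0 \<omega>"
    have "?x powr (3/4) \<le> \<eta> * ?x + \<eta> powr - 3"
    proof (cases "\<eta> powr - 4 \<le> ?x")
      case True
      have "?x powr (3/4) = ?x * ?x powr (- 1/4)"
        using elim by (simp add: powr_mult_base)
      also have "\<dots> \<le> ?x * (\<eta> powr - 4) powr (- 1/4)"
        using elim True \<open>0 < \<eta>\<close> by (intro mult_left_mono powr_mono2') auto
      also have "(\<eta> powr - 4) powr (- 1/4) = \<eta>"
        using \<open>0 < \<eta>\<close> by (simp add: powr_powr)
      finally show ?thesis by (simp add: mult.commute add_increasing2)
    next
      case False
      then have "?x powr (3/4) \<le> (\<eta> powr - 4) powr (3/4)"
        using elim by (intro powr_mono2) auto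
      also have "\<dots> = \<eta> powr - 3" by (simp add: powr_powr)
      finally show ?thesis using elim \<open>0 < \<eta>\<close> by (simp add: add_increasing)
    qed
    then show ?case by (simp add: g_def b_def algebra_simps)
  qed
  moreover have "integrable M (\<lambda>\<omega>. g (Z 0 \<omega>))" unfolding g_def using int intY by simp
  moreover have "expectation (\<lambda>\<omega>. g (Z 0 \<omega>)) = (\<mu> - \<mu> - \<epsilon>) - \<eta> * (5/3 - 5/3 - u)"
    unfolding g_def using int intY by (simp add: prob_space mean \<mu>[symmetric])
  then have "expectation (\<lambda>\<omega>. g (Z 0 \<omega>)) < 0"
    using \<open>\<eta> * u = \<epsilon> / 2\<close> \<open>0 < \<epsilon>\<close> by simp
  ultimately obtain I where I: "0 < I" "\<And>n. prob {\<omega> \<in> space M. 0 \<le> (\<Sum>i=1..n. g (Z i \<omega>))} \<le> exp (- (real n * I))"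
    using g.bounded_above_large_deviation by blast
  have "prob {\<omega> \<in> space M. S_hat Z n \<omega> - \<mu> > \<epsilon> \<and> \<bar>T_hat Z n \<omega> - 5/3\<bar> < u} \<le> exp (- (real n * I))"
    if "n \<ge> 1" for n
  proof -
    have "prob {\<omega> \<in> space M. S_hat Z n \<omega> - \<mu> > \<epsilon> \<and> \<bar>T_hat Z n \<omega> - 5/3\<bar> < u}
        \<le> prob {\<omega> \<in> space M. 0 \<le> (\<Sum>i=1..n. g (Z i \<omega>))}"
    proof (intro finite_measure_mono subsetI)
      fix \<omega> assume "\<omega> \<in> {\<omega> \<in> space M. S_hat Z n \<omega> - \<mu> > \<epsilon> \<and> \<bar>T_hat Z n \<omega> - 5/3\<bar> < u}"
      then have \<omega>: "\<omega> \<in> space M" "S_hat Z n \<omega> - \<mu> > \<epsilon>" "T_hat Z n \<omega> - 5/3 < u" by auto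
      have "(\<Sum>i=1..n. g (Z i \<omega>)) = (\<Sum>i=1..n. Z i \<omega> powr (3/4)) - \<eta> * (\<Sum>i=1..n. Z i \<omega>)
          - real n * (\<mu> + \<epsilon> - \<eta> * (5/3 + u))"
        by (simp add: g_def sum_subtractf sum.distrib sum_distrib_left algebra_simps)
      also have "\<dots> = real n * ((S_hat Z n \<omega> - \<mu> - \<epsilon>) - \<eta> * (T_hat Z n \<omega> - 5/3 - u))"
        using that by (simp add: S_hat_def T_hat_def algebra_simps)
      finally have s: "(\<Sum>i=1..n. g (Z i \<omega>)) = real n * ((S_hat Z n \<omega> - \<mu> - \<epsilon>) - \<eta> * (T_hat Z n \<omega> - 5/3 - u))" .
      have "\<eta> * (T_hat Z n \<omega> - 5/3 - u) \<le> 0"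
        using \<omega> \<open>0 < \<eta>\<close> by (intro mult_nonneg_nonpos) auto
      then have "0 \<le> (\<Sum>i=1..n. g (Z i \<omega>))"
        unfolding s using \<omega>(2) by (intro mult_nonneg_nonneg) simp_all
      then show "\<omega> \<in> {\<omega> \<in> space M. 0 \<le> (\<Sum>i=1..n. g (Z i \<omega>))}"
        using \<omega>(1) by simp
    qed measurable
    with I(2)[of n] show ?thesis by simp
  qed
  with I(1) show ?thesis by blast
qed

end

section \<open>From the density to the sequence of samples\<close>

lemma iid_with_density_iid_sequence:
  assumes "prob_space M" "iid_with_density M X f"
  shows "iid_sequence M X"
proof -
  interpret prob_space M by fact
  show ?thesis
  proof
    show "indep_vars (\<lambda>_. borel) X UNIV" using assms(2) by (simp add: iid_with_density_def)
    have "distr M borel (X i) = density lborel (\<lambda>x. ennreal (f x))" for i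
    proof -
      have "distributed M lborel (X i) (\<lambda>x. ennreal (f x))"
        using assms(2) by (simp add: iid_with_density_def)
      then have "distr M lborel (X i) = density lborel (\<lambda>x. ennreal (f x))"
        by (simp add: distributed_def)
      \<comment> \<open>The target measure of \<open>distr\<close> matters only through its
        sigma-algebra, which \<open>borel\<close> and \<open>lborel\<close> share.\<close>
      moreover have "distr M borel (X i) = distr M lborel (X i)"
        by (rule distr_cong) auto
      ultimately show ?thesis by simp
    qed
    then show "distr M borel (X i) = distr M borel (X 0)" for i by simp
  qed
qed

lemma density_on_ge_1_AE_ge_1:
  assumes "density_on_ge_1 f" "distributed M lborel Y (\<lambda>x. ennreal (f x))"
  shows "AE \<omega> in M. 1 \<le> Y \<omega>"
proof -
  have Y: "Y \<in> measurable M lborel" and d: "distr M lborel Y = density lborel (\<lambda>x. ennreal (f x))"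
    and f: "(\<lambda>x. ennreal (f x)) \<in> borel_measurable lborel"
    using assms(2) by (auto simp: distributed_def)
  have "AE x in density lborel (\<lambda>x. ennreal (f x)). 1 \<le> x"
    unfolding AE_density[OF f] using assms(1)
    by (intro AE_I2) (auto simp: density_on_ge_1_def not_le[symmetric])
  then show ?thesis using AE_distrD[OF Y] unfolding d by simp
qed

text \<open>Used with \<open>p = 5/2\<close> for the Pareto tail and with \<open>p = 1\<close> for
  the second moment of the power 3/4.\<close>

lemma nn_integral_powr_atLeast:
  fixes a p :: real
  assumes "0 < a" "0 < p"
  shows "(\<integral>\<^sup>+x. ennreal (x powr (- p - 1)) * indicator {a..} x \<partial>lborel) = ennreal (a powr - p / p)"
proof -
  have "((\<lambda>x. - (x powr - p / p)) \<longlongrightarrow> 0) at_top" using assms by real_asymp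
  then have "(\<integral>\<^sup>+x. ennreal (x powr (- p - 1)) * indicator {a..} x \<partial>lborel) = ennreal (0 - (- (a powr - p / p)))"
    using assms by (intro nn_integral_FTC_atLeast) (auto intro!: derivative_eq_intros)
  then show ?thesis by simp
qed

section \<open>The Pareto density: tail and second moment\<close>

context
  fixes M :: "'a measure" and Y :: "'a \<Rightarrow> real" and f :: "real \<Rightarrow> real"
  assumes prob: "prob_space M" and dens: "density_on_ge_1 f"
    and distr: "distributed M lborel Y (\<lambda>x. ennreal (f x))"
    and pareto: "\<forall>x\<ge>1. f x = 5 / (2 * x powr (7/2))"
begin

interpretation prob_space M by (rule prob)

lemma pareto_density_eq:
  "ennreal (f x) = ennreal (5/2) * (ennreal (x powr (- (5/2) - 1)) * indicator {1..} x)"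
proof (cases "1 \<le> x")
  case True
  then have "f x = 5/2 * x powr (- (5/2) - 1)" using pareto by (simp add: powr_minus field_simps)
  then have "ennreal (f x) = ennreal (5/2) * ennreal (x powr (- (5/2) - 1))"
    by (simp only:) (rule ennreal_mult, auto)
  with True show ?thesis by simp
next
  case False
  with dens show ?thesis by (simp add: density_on_ge_1_def)
qed

lemma pareto_tail:
  assumes "1 \<le> y"
  shows "prob {\<omega> \<in> space M. Y \<omega> > y} = y powr - (5/2)"
proof -
  have "emeasure M (Y -` {y<..} \<inter> space M) = (\<integral>\<^sup>+x. ennreal (f x) * indicator {y<..} x \<partial>lborel)"
    using distr by (rule distributed_emeasure) simp
  also have "\<dots> = (\<integral>\<^sup>+x. ennreal (5/2) * (ennreal (x powr (- (5/2) - 1)) * indicator {y..} x) \<partial>lborel)"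
  proof (rule nn_integral_cong_AE)
    show "AE x in lborel. ennreal (f x) * indicator {y<..} x =
        ennreal (5/2) * (ennreal (x powr (- (5/2) - 1)) * indicator {y..} x)"
      \<comment> \<open>The open and closed half-lines differ only at the null point
        \<open>y\<close>.\<close>
      using AE_lborel_singleton[of y]
      by eventually_elim (use assms in \<open>auto simp: pareto_density_eq indicator_def\<close>)
  qed
  also have "\<dots> = ennreal (5/2) * ennreal (y powr - (5/2) / (5/2))"
    by (subst nn_integral_cmult, simp, subst nn_integral_powr_atLeast) (use assms in auto)
  also have "\<dots> = ennreal (y powr - (5/2))"
    by (subst ennreal_mult[symmetric]) auto
  finally have "emeasure M (Y -` {y<..} \<inter> space M) = ennreal (y powr - (5/2))" .
  then have "prob (Y -` {y<..} \<inter> space M) = y powr - (5/2)" by (simp add: measure_def)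
  also have "Y -` {y<..} \<inter> space M = {\<omega> \<in> space M. Y \<omega> > y}" by auto
  finally show ?thesis .
qed

text \<open>The square contributes \<open>x powr (3/2)\<close>, so the integrand against Lebesgue
  measure is a multiple of \<open>x powr - 2\<close>.\<close>

lemma pareto_square_integrable: "integrable M (\<lambda>\<omega>. (Y \<omega> powr (3/4))\<^sup>2)"
proof -
  have [measurable]: "Y \<in> borel_measurable M" using distr by (simp add: distributed_def)
  have "(\<integral>\<^sup>+\<omega>. ennreal ((Y \<omega> powr (3/4))\<^sup>2) \<partial>M) = (\<integral>\<^sup>+x. ennreal (f x) * ennreal ((x powr (3/4))\<^sup>2) \<partial>lborel)"
    using distributed_nn_integral[OF distr, of "\<lambda>x. ennreal ((x powr (3/4))\<^sup>2)"] by simp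
  also have "\<dots> = (\<integral>\<^sup>+x. ennreal (5/2) * (ennreal (x powr (- 1 - 1)) * indicator {1..} x) \<partial>lborel)"
  proof (rule nn_integral_cong)
    fix x :: real
    show "ennreal (f x) * ennreal ((x powr (3/4))\<^sup>2) = ennreal (5/2) * (ennreal (x powr (- 1 - 1)) * indicator {1..} x)"
    proof (cases "1 \<le> x")
      case True
      then have "x powr (- (5/2) - 1) * (x powr (3/4))\<^sup>2 = x powr (- 1 - 1)"
        by (simp add: power2_eq_square flip: powr_add)
      then show ?thesis
        using True by (simp add: pareto_density_eq mult.assoc flip: ennreal_mult)
    qed (simp add: pareto_density_eq)
  qed
  also have "\<dots> = ennreal (5/2) * ennreal (1 powr - 1 / 1)"
    by (subst nn_integral_cmult, simp, subst nn_integral_powr_atLeast, auto)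
  also have "\<dots> < \<infinity>" by (simp add: ennreal_mult_less_top)
  finally show ?thesis by (intro integrableI_nonneg) auto
qed

end

text \<open>The power 3/4 turns the tail exponent 5/2 into
  \<open>\<alpha> = 4/3 * 5/2 = 10/3\<close>, and the \<open>n\<close> possible positions of the
  jump raise the power of \<open>n\<close> from -10/3 to -7/3.\<close>

lemma pareto_one_big_jump:
  assumes "prob_space M" "density_on_ge_1 f" and iid: "iid_with_density M X f"
    and \<mu>: "\<mu> = prob_space.expectation M (\<lambda>\<omega>. X 0 \<omega> powr (3/4))"
    and pareto: "\<forall>x\<ge>1. f x = 5 / (2 * x powr (7/2))" and "0 < \<epsilon>"
  shows "(\<lambda>n. prob_space.prob M {\<omega> \<in> space M. S_hat X n \<omega> - \<mu> > \<epsilon>})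
    \<sim>[sequentially] (\<lambda>n. 1 / (\<epsilon> powr (10/3) * real n powr (7/3)))"
proof -
  interpret iid_sequence M X using assms(1) iid by (rule iid_with_density_iid_sequence)
  have distr: "distributed M lborel (X 0) (\<lambda>x. ennreal (f x))"
    using iid by (simp add: iid_with_density_def)
  note sq = pareto_square_integrable[OF assms(1,2) distr pareto]
  have int: "integrable M (\<lambda>\<omega>. X 0 \<omega> powr (3/4))"
    using sq by (rule square_integrable_imp_integrable[rotated]) simp
  have ge1: "AE \<omega> in M. 1 \<le> X 0 \<omega>" by (rule density_on_ge_1_AE_ge_1[OF assms(2) distr])
  have tail: "prob {\<omega> \<in> space M. X 0 \<omega> powr (3/4) > y} = y powr - (10/3)" if "1 \<le> y" for y
  proof -
    have iff: "x powr (3/4) > y \<longleftrightarrow> x > y powr (4/3)" if "1 \<le> x" for x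
    proof -
      have y: "(y powr (4/3)) powr (3/4) = y" using \<open>1 \<le> y\<close> by (simp add: powr_powr)
      show ?thesis
        using that powr_less_mono2[of "3/4" "y powr (4/3)" x] powr_mono2[of "3/4" x "y powr (4/3)"]
        unfolding y by (auto simp: not_le[symmetric])
    qed
    have "prob {\<omega> \<in> space M. X 0 \<omega> powr (3/4) > y} = prob {\<omega> \<in> space M. X 0 \<omega> > y powr (4/3)}"
      using ge1 by (intro finite_measure_eq_AE) (auto elim!: eventually_mono simp: iff)
    also have "\<dots> = (y powr (4/3)) powr - (5/2)"
      using that by (intro pareto_tail[OF assms(1,2) distr pareto]) (auto intro: ge_one_powr_ge_zero)
    finally show ?thesis by (simp add: powr_powr)
  qed
  interpret Y: iid_sequence M "\<lambda>i \<omega>. X i \<omega> powr (3/4) - \<mu>"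
    by (rule iid_sequence_compose[where g = "\<lambda>x. x powr (3/4) - \<mu>"]) simp
  interpret Y: centered_iid_sequence M "\<lambda>i \<omega>. X i \<omega> powr (3/4) - \<mu>"
  proof
    show "integrable M (\<lambda>\<omega>. X 0 \<omega> powr (3/4) - \<mu>)" using int by simp
    show "integrable M (\<lambda>\<omega>. (X 0 \<omega> powr (3/4) - \<mu>)\<^sup>2)" using int sq by (simp add: power2_diff)
    show "expectation (\<lambda>\<omega>. X 0 \<omega> powr (3/4) - \<mu>) = 0" using int \<mu> by (simp add: prob_space)
  qed
  \<comment> \<open>Centring shifts the argument of the tail by \<open>\<mu>\<close>, which is
    negligible at infinity; the exact tail formula applies once \<open>y + \<mu>\<close> is at least
    1.\<close>
  have "((\<lambda>y. y powr (10/3) * (y + \<mu>) powr - (10/3)) \<longlongrightarrow> 1) at_top"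
    by real_asymp
  moreover have "\<forall>\<^sub>F y in at_top. y powr (10/3) * (y + \<mu>) powr - (10/3) = y powr (10/3) * Y.G y"
    using eventually_ge_at_top[of "1 - \<mu>"]
  proof eventually_elim
    case (elim y)
    have "Y.G y = prob {\<omega> \<in> space M. X 0 \<omega> powr (3/4) > y + \<mu>}" by (simp add: less_diff_eq)
    then show ?case using elim by (simp add: tail)
  qed
  ultimately have "((\<lambda>y. y powr (10/3) * Y.G y) \<longlongrightarrow> 1) at_top"
    by (rule Lim_transform_eventually)
  from Y.one_big_jump[OF _ this \<open>0 < \<epsilon>\<close>]
  have "(\<lambda>n. prob {\<omega> \<in> space M. (\<Sum>i=1..n. X i \<omega> powr (3/4) - \<mu>) > real n * \<epsilon>})
      \<sim>[sequentially] (\<lambda>n. real n * (real n * \<epsilon>) powr - (10/3))"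
    by simp
  moreover have "\<forall>\<^sub>F n in sequentially. prob {\<omega> \<in> space M. (\<Sum>i=1..n. X i \<omega> powr (3/4) - \<mu>) > real n * \<epsilon>} =
      prob {\<omega> \<in> space M. S_hat X n \<omega> - \<mu> > \<epsilon>}"
    using eventually_gt_at_top[of 0]
  proof eventually_elim
    case (elim n)
    have "(\<Sum>i=1..n. X i \<omega> powr (3/4) - \<mu>) > real n * \<epsilon> \<longleftrightarrow> S_hat X n \<omega> - \<mu> > \<epsilon>" for \<omega>
    proof -
      have "(\<Sum>i=1..n. X i \<omega> powr (3/4) - \<mu>) = real n * (S_hat X n \<omega> - \<mu>)"
        using elim by (simp add: S_hat_def sum_subtractf algebra_simps)
      then show ?thesis using elim by simp
    qed
    then show ?case by simp
  qed
  moreover have "\<forall>\<^sub>F n in sequentially. real n * (real n * \<epsilon>) powr - (10/3) = 1 / (\<epsilon> powr (10/3) * real n powr (7/3))"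
    using eventually_gt_at_top[of 0]
  proof eventually_elim
    case (elim n)
    then have "real n * real n powr - (10/3) = real n powr - (7/3)"
      by (simp add: powr_mult_base)
    moreover have "real n * (real n * \<epsilon>) powr - (10/3) = (real n * real n powr - (10/3)) * \<epsilon> powr - (10/3)"
      using \<open>0 < \<epsilon>\<close> by (simp add: powr_mult)
    ultimately show ?case by (simp add: powr_minus_divide)
  qed
  ultimately show ?thesis by (rule asymp_equiv_transfer)
qed

section \<open>Assembling the four claims\<close>

theorem proposition1p1:
  fixes M :: "'a measure" and X :: "nat \<Rightarrow> 'a \<Rightarrow> real" and f :: "real \<Rightarrow> real" and \<mu> :: real
  assumes "prob_space M"
    and "density_on_ge_1 f"
    and "iid_with_density M X f"
    and "\<mu> = prob_space.expectation M (\<lambda>\<omega>. X 0 \<omega> powr (3/4))"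
  shows
    "((\<forall>x\<ge>1. f x = 5 / (2 * x powr (7/2))) \<longrightarrow>
        (\<forall>\<epsilon>>0.
          (\<lambda>n. prob_space.prob M {\<omega> \<in> space M. S_hat X n \<omega> - \<mu> > \<epsilon>})
            \<sim>[sequentially] (\<lambda>n. 1 / (\<epsilon> powr (10/3) * real n powr (7/3)))))
     \<and>
     (prob_space.expectation M (X 0) = 5/3 \<longrightarrow>
        (\<forall>\<epsilon>>0. \<forall>u>0. \<exists>I>0. \<forall>n\<ge>1.
          prob_space.prob M {\<omega> \<in> space M. S_hat X n \<omega> - \<mu> > \<epsilon> \<and> \<bar>T_hat X n \<omega> - 5/3\<bar> < u}
            \<le> exp (- (real n * I))))
     \<and>
     (prob_space.expectation M (X 0) = 5/3 \<and> prob_space.variance M (X 0) = 20/9 \<longrightarrow>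
        (\<forall>\<epsilon>>0. \<forall>u. 0 < u \<and> u \<le> \<epsilon> / 20 \<longrightarrow> (\<forall>n\<ge>1.
          prob_space.prob M {\<omega> \<in> space M. S_hat X n \<omega> - \<mu> > \<epsilon> \<and> \<bar>T_hat X n \<omega> - 5/3\<bar> < u}
            \<le> exp (- (0.005 * real n * \<epsilon>\<^sup>2)))))
     \<and>
     (prob_space.expectation M (X 0) = 5/3 \<and> prob_space.variance M (X 0) = 20/9
        \<and> covariance M (\<lambda>\<omega>. X 0 \<omega> powr (3/4)) (X 0) = 20/21 \<longrightarrow>
        (\<forall>\<epsilon>>0. \<forall>u. 0 < u \<and> u \<le> \<epsilon> / 20 \<longrightarrow> (\<forall>n\<ge>1.
          prob_space.prob M {\<omega> \<in> space M. S_hat X n \<omega> - \<mu> > \<epsilon> \<and> \<bar>T_hat X n \<omega> - 5/3\<bar> < u}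
            \<le> exp (- (0.0367 * real n * \<epsilon>\<^sup>2)))))"
proof -
  interpret iid_sequence M X using assms(1,3) by (rule iid_with_density_iid_sequence)
  have ge1: "AE \<omega> in M. 1 \<le> X 0 \<omega>"
    using assms(2,3) by (intro density_on_ge_1_AE_ge_1) (auto simp: iid_with_density_def)
  note joint = three_quarters_power_joint_deviation[OF ge1 _ _ assms(4)]
  \<comment> \<open>The third claim follows from \<open>joint\<close> by lowering the rate.\<close>
  have weaker: "exp (- (0.0367 * real n * \<epsilon>\<^sup>2)) \<le> exp (- (0.005 * real n * \<epsilon>\<^sup>2))" for n and \<epsilon> :: real
    by (simp add: mult_right_mono)
  show ?thesis
  proof (intro conjI impI allI)
    show "(\<lambda>n. prob {\<omega> \<in> space M. S_hat X n \<omega> - \<mu> > \<epsilon>})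
        \<sim>[sequentially] (\<lambda>n. 1 / (\<epsilon> powr (10/3) * real n powr (7/3)))"
      if "\<forall>x\<ge>1. f x = 5 / (2 * x powr (7/2))" "0 < \<epsilon>" for \<epsilon>
      by (rule pareto_one_big_jump[OF assms that])
    show "\<exists>I>0. \<forall>n\<ge>1. prob {\<omega> \<in> space M. S_hat X n \<omega> - \<mu> > \<epsilon> \<and> \<bar>T_hat X n \<omega> - 5/3\<bar> < u}
        \<le> exp (- (real n * I))"
      if "expectation (X 0) = 5/3" "0 < \<epsilon>" "0 < u" for \<epsilon> u
      by (rule joint_deviation_exponential[OF ge1 that(1) assms(4) that(2,3)])
    show "prob {\<omega> \<in> space M. S_hat X n \<omega> - \<mu> > \<epsilon> \<and> \<bar>T_hat X n \<omega> - 5/3\<bar> < u}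
        \<le> exp (- (0.005 * real n * \<epsilon>\<^sup>2))"
      if "expectation (X 0) = 5/3 \<and> variance (X 0) = 20/9" "0 < \<epsilon>" "0 < u \<and> u \<le> \<epsilon> / 20" "1 \<le> n" for \<epsilon> u n
      using that by (intro order_trans[OF joint weaker]) auto
    show "prob {\<omega> \<in> space M. S_hat X n \<omega> - \<mu> > \<epsilon> \<and> \<bar>T_hat X n \<omega> - 5/3\<bar> < u}
        \<le> exp (- (0.0367 * real n * \<epsilon>\<^sup>2))"
      if "expectation (X 0) = 5/3 \<and> variance (X 0) = 20/9
          \<and> covariance M (\<lambda>\<omega>. X 0 \<omega> powr (3/4)) (X 0) = 20/21"
        "0 < \<epsilon>" "0 < u \<and> u \<le> \<epsilon> / 20" "1 \<le> n" for \<epsilon> u n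
      using that by (intro joint) auto
  qed
qed

end
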